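(* Let $\beta\ge0$. Let $f:\mathbb R^N\to\mathbb R$ be a convex function which is twice continuously differentiable, and such that $\inf_{\mathbb R^N}f>-\infty$. Suppose that $\nabla f$ and $\nabla^2f$ are Lipschitz continuous on the bounded subsets of $\mathbb R^N$. For $\lambda>0$ let $E_\lambda:\mathbb R^N\times\mathbb R^N\to\mathbb R$ be defined by $$E_\lambda(x,u):=\tfrac12\|u\|^2+f(x)+\lambda\langle\nabla f(x),u\rangle .$$ Suppose that, for all sufficiently small $\lambda>0$, $E_\lambda$ satisfies the (KL) property. Let $\phi:\mathbb R^N\to\mathbb R_+$ be a damping potential which is differentiable, with $\nabla\phi$ locally Lipschitz continuous, and which satisfies the following growth conditions: (a) (local) there exist positive constants $\gamma,\delta,\epsilon$ such that, for all $u\in\mathbb R^N$ with $\|u\|\le\epsilon$, $\phi(u)\ge\gamma\|u\|^2$ and $\|\nabla\phi(u)\|\le\delta\|u\|$; (b) (global) there exist $p\ge1$ and $c>0$ such that $\phi(u)\ge c\|u\|^p$ for all $u\in\mathbb R^N$. Let $x:[0,+\infty[\to\mathbb R^N$ be a bounded solution trajectory of $$\ddot x(t)+\nabla\phi(\dot x(t))+\beta\nabla^2f(x(t))\dot x(t)+\nabla f(x(t))=0 .$$ Then: (i) $x(t)\to x_\infty$ as $t\to+\infty$, where $\nabla f(x_\infty)=0$; (ii) $\dot x\in L^1(0,+\infty;\mathbb R^N)$ and $\dot x(t)\to0$ as $t\to+\infty$; (iii) for all $\lambda>0$ sufficiently small there exists $\alpha>0$ for which the angle condition $$\langle\nabla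 E_\lambda(x,u),F(x,u)\rangle\ge\alpha\|\nabla E_\lambda(x,u)\|\,\|F(x,u)\|$$ holds for all $(x,u)\in\Gamma$, and, for all $t$ sufficiently large, $$\|x(t)-x_\infty\|\le\frac1\alpha\,\theta\big(E_\lambda(x(t),\dot x(t))-E_\lambda(x_\infty,0)\big),$$ where $\theta$ is the desingularizing function for $E_\lambda$ at $(x_\infty,0)$.
   Context: $\mathbb R^N$ carries its Euclidean structure. A function $\phi:\mathbb R^N\to\mathbb R_+$ is a damping potential if it is nonnegative, convex and continuous, with $\phi(0)=0=\min\phi$ (and the minimal-norm element of $\partial\phi(u)$ is bounded on bounded sets, which is automatic in finite dimension). (KL) property: a differentiable function $G:\mathbb R^m\to\mathbb R$ satisfies the (KL) property if for each critical point $\bar z$ of $G$ there exist $\eta>0$, a neighborhood $U$ of $\bar z$ and a continuous concave increasing function $\theta:[0,\eta)\to[0,+\infty)$ with $\theta(0)=0$, $\theta\in\mathcal C^1(0,\eta)$ and $\theta'>0$ on $(0,\eta)$, such that $\theta'(G(z)-G(\bar z))\,\|\nabla G(z)\|\ge1$ for all $z\in U$ with $G(\bar z)<G(z)<G(\bar z)+\eta$. Such a $\theta$ is called a desingularizing function for $G$ at $\bar z$. Here $F(x,u)=(-u,\ \nabla\phi(u)+\nabla f(x)+\beta\nabla^2f(x)u)$ on $\mathbb R^N\times\mathbb R^N$, and $\Gamma=\bar B(0,R)\times\bar B(0,\epsilon)$ where $R\ge\sup_{t\ge0}\|x(t)\|$ and $\epsilon$ is the constant of condition (a). *)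

theory Defs
  imports "HOL-Analysis.Analysis"
begin

definition grad :: "('a::real_inner \<Rightarrow> real) \<Rightarrow> 'a \<Rightarrow> 'a" where
  "grad f x = (THE D. GDERIV f x :> D)"

(* The Hessian as a bounded operator, so that continuity and Lipschitz continuity
   of the Hessian refer to the operator norm. *)
definition hess :: "('a::real_inner \<Rightarrow> real) \<Rightarrow> 'a \<Rightarrow> 'a \<Rightarrow>\<^sub>L 'a" where
  "hess f x = Blinfun (frechet_derivative (grad f) (at x))"

definition twice_cont_differentiable :: "('a::real_inner \<Rightarrow> real) \<Rightarrow> bool" where
  "twice_cont_differentiable f \<longleftrightarrow>
     (\<forall>x. f differentiable (at x)) \<and> (\<forall>x. grad f differentiable (at x)) \<and>
     continuous_on UNIV (hess f)"

definition lipschitz_on_bounded_sets ::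
    "('a::metric_space \<Rightarrow> 'b::metric_space) \<Rightarrow> bool" where
  "lipschitz_on_bounded_sets g \<longleftrightarrow> (\<forall>B. bounded B \<longrightarrow> (\<exists>L. L-lipschitz_on B g))"

definition locally_lipschitz ::
    "('a::metric_space \<Rightarrow> 'b::metric_space) \<Rightarrow> bool" where
  "locally_lipschitz g \<longleftrightarrow> (\<forall>u. \<exists>r>0. \<exists>L. L-lipschitz_on (ball u r) g)"

definition subdifferential :: "('a::real_inner \<Rightarrow> real) \<Rightarrow> 'a \<Rightarrow> 'a set" where
  "subdifferential \<phi> u = {\<xi>. \<forall>v. \<phi> v \<ge> \<phi> u + inner \<xi> (v - u)}"

(* The last conjunct says that the minimal-norm element of the subdifferential is
   bounded on bounded sets; in finite dimension it follows from the others. *)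
definition damping_potential :: "('a::real_inner \<Rightarrow> real) \<Rightarrow> bool" where
  "damping_potential \<phi> \<longleftrightarrow>
     (\<forall>u. \<phi> u \<ge> 0) \<and> convex_on UNIV \<phi> \<and> continuous_on UNIV \<phi> \<and> \<phi> 0 = 0 \<and>
     (\<forall>B. bounded B \<longrightarrow>
        bounded {\<xi>. \<exists>u\<in>B. \<xi> \<in> subdifferential \<phi> u \<and>
                            (\<forall>\<zeta>\<in>subdifferential \<phi> u. norm \<xi> \<le> norm \<zeta>)})"

(* Only the values of \<theta> on [0,\<eta>) matter; elsewhere \<theta> is arbitrary. *)
definition desingularizing ::
    "('a::real_inner \<Rightarrow> real) \<Rightarrow> 'a \<Rightarrow> (real \<Rightarrow> real) \<Rightarrow> bool" where
  "desingularizing G z0 \<theta> \<longleftrightarrow>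
     (\<exists>\<eta>>0. \<exists>U. open U \<and> z0 \<in> U \<and>
        continuous_on {0..<\<eta>} \<theta> \<and> concave_on {0..<\<eta>} \<theta> \<and> mono_on {0..<\<eta>} \<theta> \<and>
        (\<forall>s\<in>{0..<\<eta>}. \<theta> s \<ge> 0) \<and> \<theta> 0 = 0 \<and>
        \<theta> C1_differentiable_on {0<..<\<eta>} \<and> (\<forall>s\<in>{0<..<\<eta>}. deriv \<theta> s > 0) \<and>
        (\<forall>z\<in>U. G z0 < G z \<and> G z < G z0 + \<eta> \<longrightarrow>
           deriv \<theta> (G z - G z0) * norm (grad G z) \<ge> 1))"

definition KL_property :: "('a::real_inner \<Rightarrow> real) \<Rightarrow> bool" where
  "KL_property G \<longleftrightarrow>
     (\<forall>z. G differentiable (at z)) \<and>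
     (\<forall>z0. grad G z0 = 0 \<longrightarrow> (\<exists>\<theta>. desingularizing G z0 \<theta>))"

definition energy :: "('a::real_inner \<Rightarrow> real) \<Rightarrow> real \<Rightarrow> 'a \<times> 'a \<Rightarrow> real" where
  "energy f lam = (\<lambda>(x, u). (norm u)\<^sup>2 / 2 + f x + lam * inner (grad f x) u)"

definition vfield ::
    "real \<Rightarrow> ('a::real_inner \<Rightarrow> real) \<Rightarrow> ('a \<Rightarrow> real) \<Rightarrow> 'a \<times> 'a \<Rightarrow> 'a \<times> 'a" where
  "vfield \<beta> f \<phi> =
     (\<lambda>(x, u). (- u, grad \<phi> u + grad f x + \<beta> *\<^sub>R blinfun_apply (hess f x) u))"

lemma GDERIV_grad:
  fixes f :: "'a::euclidean_space \<Rightarrow> real"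
  assumes "f differentiable (at x)"
  shows "GDERIV f x :> grad f x"
proof -
  obtain f' where f': "(f has_derivative f') (at x)"
    using assms by (auto simp: differentiable_def)
  interpret bounded_linear f' using f' by (rule has_derivative_bounded_linear)
  define D where "D = (\<Sum>b\<in>Basis. f' b *\<^sub>R b)"
  have "f' h = inner h D" for h
  proof -
    have "f' h = f' (\<Sum>b\<in>Basis. inner h b *\<^sub>R b)"
      by (simp only: euclidean_representation)
    also have "\<dots> = inner h D"
      by (simp add: D_def sum scaleR inner_sum_right mult.commute)
    finally show ?thesis .
  qed
  then have "f' = (\<lambda>h. inner h D)"
    by (rule ext)
  with f' have D: "GDERIV f x :> D"
    by (simp add: gderiv_def)
  have "D' = D" if "GDERIV f x :> D'" for D'
  proof -
    have "(\<lambda>h. inner h D') = (\<lambda>h. inner h D)"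
      using has_derivative_unique that D by (auto simp: gderiv_def)
    then have "inner h D' = inner h D" for h
      by (rule fun_cong)
    then show ?thesis
      using vector_eq_ldot by blast
  qed
  with D show ?thesis
    unfolding grad_def by (rule theI)
qed

lemma has_derivative_grad:
  assumes "grad f differentiable (at x)"
  shows "(grad f has_derivative blinfun_apply (hess f x)) (at x)"
  using assms unfolding hess_def
  by (simp add: bounded_linear_Blinfun_apply frechet_derivative_works
      has_derivative_bounded_linear)

end

theory Submission
  imports Defs
begin

text \<open>
  Write the equation as the first-order system \<open>(x, u)' = - F(x, u)\<close> with \<open>u = x'\<close>. The mechanical
  energy \<open>\<parallel>u\<parallel>\<^sup>2/2 + f(x)\<close> decreases at the rate \<open>\<langle>\<nabla>\<phi>(u), u\<rangle> + \<beta>\<langle>\<nabla>\<^sup>2f(x)u, u\<rangle>\<close>, which is at least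
  \<open>\<phi>(u)\<close> by convexity; but it does not see \<open>\<nabla>f(x)\<close> and hence is no gradient-like function for \<open>F\<close>.
  Adding \<open>\<lambda>\<langle>\<nabla>f(x), u\<rangle>\<close> repairs this: differentiating the extra term along the motion produces
  \<open>- \<lambda>\<parallel>\<nabla>f(x)\<parallel>\<^sup>2\<close>, and for small \<open>\<lambda>\<close> the unwanted terms are absorbed by the damping, which is at
  least quadratic near \<open>u = 0\<close>. On a bounded set of positions and for \<open>\<parallel>u\<parallel> \<le> \<epsilon>\<close> one obtains
  \<open>\<langle>\<nabla>E, F\<rangle> \<ge> \<lambda>/2 (\<parallel>u\<parallel>\<^sup>2 + \<parallel>\<nabla>f(x)\<parallel>\<^sup>2)\<close> for \<open>E = E\<^sub>\<lambda>\<close>, while \<open>\<parallel>\<nabla>E\<parallel>\<close> and \<open>\<parallel>F\<parallel>\<close> are both at most a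
  multiple of \<open>\<parallel>u\<parallel> + \<parallel>\<nabla>f(x)\<parallel>\<close>. This is the angle condition (\<open>inertial_system.angle_condition\<close>).

  Curves that satisfy an angle condition behave like gradient curves
  (locale \<open>angle_trajectory\<close>): the KL inequality at a cluster point bounds the length still to be
  travelled by \<open>\<theta>(E - E_inf)/\<alpha>\<close>, where \<open>E_inf\<close> is the limit of the energy
  (\<open>length_le_desingularized_gap\<close>). Hence a curve that comes close enough to the cluster point, at
  a late enough time, is trapped near it. This yields convergence (\<open>tendsto_cluster_point\<close>),
  finite length and the rate (\<open>convergence_rate\<close>).

  It remains to bring the trajectory into this situation. If a function bounded below decreases at
  least at the rate \<open>c\<parallel>y\<parallel>\<^sup>p\<close> with \<open>y\<close> Lipschitz, then \<open>y\<close> tends to zero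
  (\<open>tendsto_zero_if_dissipated\<close>). Applied to
  the mechanical energy, with the growth \<open>\<phi>(u) \<ge> c\<parallel>u\<parallel>\<^sup>p\<close>, this gives \<open>x' \<rightarrow> 0\<close>, so that
  \<open>\<parallel>x'\<parallel> \<le> \<epsilon>\<close> eventually; applied to \<open>E\<close> it then gives \<open>\<nabla>f(x) \<rightarrow> 0\<close>. Thus every cluster point of
  \<open>(x, x')\<close> has the form \<open>(x_inf, 0)\<close> with \<open>\<nabla>f(x_inf) = 0\<close>, and is a critical point of \<open>E\<close>, where the
  KL property supplies a desingularizing function.
\<close>

section \<open>Convex functions and their Hessian\<close>

lemma convex_above_tangent_plane:
  fixes f :: "'a::euclidean_space \<Rightarrow> real"
  assumes "convex_on UNIV f" and "f differentiable (at x)"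
  shows "f y \<ge> f x + inner (grad f x) (y - x)"
proof -
  define g where "g t = f (x + t *\<^sub>R (y - x))" for t :: real
  have "convex_on UNIV g"
  proof (rule convex_onI)
    fix t a b :: real
    assume "0 < t" "t < 1"
    have "x + ((1 - t) * a + t * b) *\<^sub>R (y - x)
        = (1 - t) *\<^sub>R (x + a *\<^sub>R (y - x)) + t *\<^sub>R (x + b *\<^sub>R (y - x))"
      by (simp add: algebra_simps)
    with convex_onD[OF assms(1), of t "x + a *\<^sub>R (y - x)" "x + b *\<^sub>R (y - x)"] \<open>0 < t\<close> \<open>t < 1\<close>
    show "g ((1 - t) *\<^sub>R a + t *\<^sub>R b) \<le> (1 - t) * g a + t * g b"
      by (simp add: g_def)
  qed simp
  moreover have "(g has_real_derivative inner (grad f x) (y - x)) (at 0)"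
  proof -
    have "(f has_derivative (\<lambda>h. inner h (grad f x))) (at (x + 0 *\<^sub>R (y - x)))"
      using GDERIV_grad[OF assms(2)] by (simp add: gderiv_def)
    then have "(g has_derivative (\<lambda>h. inner (h *\<^sub>R (y - x)) (grad f x))) (at 0)"
      unfolding g_def
      by (rule has_derivative_compose[rotated]) (auto intro!: derivative_eq_intros)
    then show ?thesis
      by (simp add: has_field_derivative_def inner_commute mult_commute_abs)
  qed
  ultimately have "inner (grad f x) (y - x) * (1 - 0) \<le> g 1 - g 0"
    by (intro convex_on_imp_above_tangent[of UNIV]) auto
  then show ?thesis by (simp add: g_def)
qed

text \<open>Along the line through \<open>x\<close> in the direction \<open>h\<close>, the slope
  \<open>\<langle>\<nabla>f(x + t h), h\<rangle>\<close> increases with \<open>t\<close> by convexity, and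
  \<open>\<langle>\<nabla>\<^sup>2f(x) h, h\<rangle>\<close> is its derivative at \<open>t = 0\<close>.\<close>

lemma convex_hess_nonneg:
  fixes f :: "'a::euclidean_space \<Rightarrow> real"
  assumes conv: "convex_on UNIV f" and diff: "\<And>x. f differentiable (at x)"
    and "grad f differentiable (at x)"
  shows "inner (blinfun_apply (hess f x) h) h \<ge> 0"
proof (rule mono_on_imp_deriv_nonneg)
  let ?k = "\<lambda>t::real. inner (grad f (x + t *\<^sub>R h)) h"
  show "mono_on UNIV ?k"
  proof (rule mono_onI)
    fix r s :: real assume "r \<le> s"
    have "f (x + s *\<^sub>R h) \<ge> f (x + r *\<^sub>R h) + inner (grad f (x + r *\<^sub>R h)) ((s - r) *\<^sub>R h)"
      using convex_above_tangent_plane[OF conv diff, where x = "x + r *\<^sub>R h" and y = "x + s *\<^sub>R h"]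
      by (simp add: algebra_simps)
    moreover
    have "f (x + r *\<^sub>R h) \<ge> f (x + s *\<^sub>R h) - inner (grad f (x + s *\<^sub>R h)) ((s - r) *\<^sub>R h)"
      using convex_above_tangent_plane[OF conv diff, where x = "x + s *\<^sub>R h" and y = "x + r *\<^sub>R h"]
      by (simp add: algebra_simps)
    ultimately have "0 \<le> (s - r) * (?k s - ?k r)"
      by (simp add: algebra_simps)
    with \<open>r \<le> s\<close> show "?k r \<le> ?k s"
      by (cases "r = s") (auto simp: zero_le_mult_iff)
  qed
  have "(grad f has_derivative blinfun_apply (hess f x)) (at (x + 0 *\<^sub>R h))"
    using has_derivative_grad[OF assms(3)] by simp
  then have "((\<lambda>t. grad f (x + t *\<^sub>R h)) has_derivative (\<lambda>t. blinfun_apply (hess f x) (t *\<^sub>R h))) (at 0)"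
    by (rule has_derivative_compose[rotated]) (auto intro!: derivative_eq_intros)
  then have "(?k has_derivative (\<lambda>t. inner (blinfun_apply (hess f x) (t *\<^sub>R h)) h)) (at 0)"
    by (rule has_derivative_inner_left)
  then show "(?k has_real_derivative inner (blinfun_apply (hess f x) h) h) (at 0)"
    by (simp add: has_field_derivative_def blinfun.scaleR_right mult_commute_abs)
qed simp

section \<open>The derivative of the perturbed energy\<close>

lemma energy_has_derivative:
  fixes f :: "'a::euclidean_space \<Rightarrow> real"
  assumes "f differentiable (at x)" and "grad f differentiable (at x)"
  shows "(energy f lam has_derivative
      (\<lambda>(h, k). inner u k + inner (grad f x) h
         + lam * (inner (blinfun_apply (hess f x) h) u + inner (grad f x) k))) (at (x, u))"
proof -
  have f: "(f has_derivative (\<lambda>h. inner h (grad f x))) (at (fst (x, u)))"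
    using GDERIV_grad[OF assms(1)] by (simp add: gderiv_def)
  have g: "(grad f has_derivative blinfun_apply (hess f x)) (at (fst (x, u)))"
    using has_derivative_grad[OF assms(2)] by simp
  have fst: "(fst has_derivative fst) (at (x, u))" and snd: "(snd has_derivative snd) (at (x, u))"
    by (auto intro: derivative_eq_intros)
  have "((\<lambda>z. inner (snd z) (snd z) / 2 + f (fst z) + lam * inner (grad f (fst z)) (snd z))
     has_derivative (\<lambda>z. (inner u (snd z) + inner (snd z) u) / 2 + inner (fst z) (grad f x)
         + lam * (inner (grad f x) (snd z) + inner (blinfun_apply (hess f x) (fst z)) u))) (at (x, u))"
    by (rule derivative_eq_intros fst snd has_derivative_compose[OF fst f]
        has_derivative_compose[OF fst g] refl | simp)+
  moreover have "(\<lambda>z. inner (snd z) (snd z) / 2 + f (fst z) + lam * inner (grad f (fst z)) (snd z))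
      = energy f lam"
    by (auto simp: energy_def power2_norm_eq_inner)
  ultimately show ?thesis
    by (simp add: inner_commute case_prod_beta' add.commute)
qed

text \<open>Describing the gradient by its inner products keeps the adjoint of the Hessian out of the
  formulas; the Hessian itself can then be estimated and tested for its sign.\<close>

lemma inner_grad_energy:
  fixes f :: "'a::euclidean_space \<Rightarrow> real"
  assumes "f differentiable (at x)" and "grad f differentiable (at x)"
  shows "inner (grad (energy f lam) (x, u)) (h, k) = inner u k + inner (grad f x) h
         + lam * (inner (blinfun_apply (hess f x) h) u + inner (grad f x) k)"
proof -
  note E = energy_has_derivative[OF assms, of lam u]
  then have "energy f lam differentiable (at (x, u))"
    by (auto simp: differentiable_def)
  from has_derivative_unique[OF GDERIV_grad[OF this, unfolded gderiv_def] E]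
  have "inner (h, k) (grad (energy f lam) (x, u)) = inner u k + inner (grad f x) h
         + lam * (inner (blinfun_apply (hess f x) h) u + inner (grad f x) k)"
    by (auto dest: fun_cong[of _ _ "(h, k)"])
  then show ?thesis by (simp only: inner_commute)
qed

section \<open>Dissipation and integrability along curves\<close>

lemma locally_lipschitz_imp_continuous_on:
  assumes "locally_lipschitz g"
  shows "continuous_on UNIV g"
proof (rule continuous_at_imp_continuous_on, rule ballI)
  fix u
  obtain r L where "r > 0" "L-lipschitz_on (ball u r) g"
    using assms unfolding locally_lipschitz_def by blast
  then show "isCont g u"
    using lipschitz_on_continuous_on continuous_on_interior[of "ball u r" g u] by auto
qed

lemma lipschitz_if_speed_bounded:
  fixes y :: "real \<Rightarrow> 'b::real_normed_vector"
  assumes "\<And>t. t \<ge> 0 \<Longrightarrow> (y has_vector_derivative y' t) (at t within {0..})"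
    and "\<And>t. t \<ge> 0 \<Longrightarrow> norm (y' t) \<le> L"
  shows "L-lipschitz_on {0..} y"
proof (rule bounded_derivative_imp_lipschitz)
  show "(y has_derivative (\<lambda>h. h *\<^sub>R y' t)) (at t within {0..})" if "t \<in> {0..}" for t
    using assms(1)[of t] that by (simp add: has_vector_derivative_def)
  show "onorm (\<lambda>h. h *\<^sub>R y' t) \<le> L" if "t \<in> {0..}" for t
    using assms(2)[of t] that onorm_scaleR_left[OF bounded_linear_ident, of "y' t"] by (simp add: onorm_id)
  show "0 \<le> L" using assms(2)[of 0] norm_ge_zero[of "y' 0"] by linarith
qed simp

lemma has_real_derivative_along_curve:
  fixes G :: "'b::euclidean_space \<Rightarrow> real"
  assumes "G differentiable (at (z t))" and "(z has_vector_derivative z') (at t within S)"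
  shows "((\<lambda>t. G (z t)) has_real_derivative inner (grad G (z t)) z') (at t within S)"
proof -
  have "((\<lambda>t. G (z t)) has_derivative (\<lambda>h. inner (h *\<^sub>R z') (grad G (z t)))) (at t within S)"
    using has_derivative_compose[OF assms(2)[unfolded has_vector_derivative_def]
        GDERIV_grad[OF assms(1), unfolded gderiv_def]] .
  then show ?thesis
    by (simp add: has_field_derivative_def inner_commute mult_commute_abs)
qed

lemma decrease_at_rate:
  fixes W :: "real \<Rightarrow> real"
  assumes "s \<le> t"
    and deriv: "\<And>r. s \<le> r \<Longrightarrow> r \<le> t \<Longrightarrow> (W has_real_derivative W' r) (at r within {s..t})"
    and rate: "\<And>r. s \<le> r \<Longrightarrow> r \<le> t \<Longrightarrow> W' r \<le> - k"
  shows "W t \<le> W s - k * (t - s)"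
proof (cases "s = t")
  case False
  with \<open>s \<le> t\<close> have "s < t" by simp
  from mvt_simple[OF this deriv[unfolded has_field_derivative_def]]
  obtain r where "r \<in> {s<..<t}" "W t - W s = W' r * (t - s)" by auto
  with rate[of r] \<open>s < t\<close> mult_right_mono[of "W' r" "- k" "t - s"] show ?thesis by auto
qed simp

text \<open>A Lipschitz curve that has norm \<open>e\<close> at some time keeps norm at least \<open>e/2\<close> on a time interval
  of fixed length \<open>h\<close>, and over this interval \<open>W\<close> loses a fixed amount \<open>d\<close>. Since \<open>W\<close> is
  nonincreasing and bounded below, this cannot happen once \<open>W\<close> is within \<open>d\<close> of its infimum.\<close>

lemma tendsto_zero_if_dissipated:
  fixes W :: "real \<Rightarrow> real" and y :: "real \<Rightarrow> 'b::real_normed_vector"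
  assumes deriv: "\<And>t. t \<ge> T \<Longrightarrow> (W has_real_derivative W' t) (at t within {T..})"
    and diss: "\<And>t. t \<ge> T \<Longrightarrow> W' t \<le> - (c * norm (y t) powr p)"
    and "c > 0" and "p \<ge> 0"
    and below: "\<And>t. t \<ge> T \<Longrightarrow> m \<le> W t"
    and lip: "L-lipschitz_on {T..} y"
  shows "(y \<longlongrightarrow> 0) at_top"
proof (rule tendstoI)
  fix e :: real assume "e > 0"
  have "L \<ge> 0" using lip by (rule lipschitz_on_nonneg)
  \<comment> \<open>During a time \<open>h\<close> the norm of \<open>y\<close> can drop by at most \<open>e/2\<close>;
    \<open>L + 1\<close> instead of \<open>L\<close> because \<open>L\<close> may vanish.\<close>
  define h where "h = e / (2 * (L + 1))"
  define d where "d = c * (e / 2) powr p * h"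
  have "h > 0" and "L * h \<le> e / 2"
    using \<open>e > 0\<close> \<open>L \<ge> 0\<close> by (auto simp: h_def field_simps)
  have "d > 0" using \<open>c > 0\<close> \<open>e > 0\<close> \<open>h > 0\<close> by (simp add: d_def)
  have decr: "W t \<le> W s - k * (t - s)"
    if "T \<le> s" "s \<le> t" "\<And>r. s \<le> r \<Longrightarrow> r \<le> t \<Longrightarrow> W' r \<le> - k" for s t k
    using that by (intro decrease_at_rate[of s t W W']) (auto intro: has_field_derivative_subset[OF deriv])
  have noninc: "W t \<le> W s" if "T \<le> s" "s \<le> t" for s t
  proof -
    have "W' r \<le> - 0" if "s \<le> r" for r
    proof -
      have "0 \<le> c * norm (y r) powr p" using \<open>c > 0\<close> by simp
      with diss[of r] that \<open>T \<le> s\<close> show ?thesis by linarith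
    qed
    from decr[of s t 0] that this show ?thesis by simp
  qed
  have bdd: "bdd_below (W ` {T..})" using below by (auto intro!: bdd_belowI[of _ m])
  have "Inf (W ` {T..}) < Inf (W ` {T..}) + d" using \<open>d > 0\<close> by simp
  then obtain t0 where "t0 \<ge> T" and t0: "W t0 < Inf (W ` {T..}) + d"
    using cInf_lessD[of "W ` {T..}" "Inf (W ` {T..}) + d"] by auto
  have "norm (y t) < e" if "t \<ge> t0" for t
  proof (rule ccontr)
    assume "\<not> norm (y t) < e"
    have "W' r \<le> - (c * (e / 2) powr p)" if "t \<le> r" "r \<le> t + h" for r
    proof -
      have "dist (y r) (y t) \<le> L * dist r t"
        using that \<open>t \<ge> t0\<close> \<open>t0 \<ge> T\<close> by (intro lipschitz_onD[OF lip]) auto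
      also have "\<dots> \<le> L * h"
        using that \<open>L \<ge> 0\<close> by (intro mult_left_mono) (auto simp: dist_real_def)
      finally have "e / 2 \<le> norm (y r)"
        using \<open>\<not> norm (y t) < e\<close> \<open>L * h \<le> e / 2\<close> norm_triangle_sub[of "y t" "y r"]
        by (simp add: dist_norm norm_minus_commute)
      then have "c * (e / 2) powr p \<le> c * norm (y r) powr p"
        using \<open>c > 0\<close> \<open>e > 0\<close> \<open>p \<ge> 0\<close> by (intro mult_left_mono powr_mono2) auto
      with diss[of r] that \<open>t \<ge> t0\<close> \<open>t0 \<ge> T\<close> show ?thesis by simp
    qed
    with decr[of t "t + h" "c * (e / 2) powr p"] \<open>t \<ge> t0\<close> \<open>t0 \<ge> T\<close> \<open>h > 0\<close>
    have "W (t + h) \<le> W t - d" by (simp add: d_def)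
    also have "\<dots> \<le> W t0 - d" using noninc \<open>t0 \<ge> T\<close> \<open>t \<ge> t0\<close> by simp
    also have "\<dots> < Inf (W ` {T..})" using t0 by simp
    also have "\<dots> \<le> W (t + h)"
      using bdd \<open>t \<ge> t0\<close> \<open>t0 \<ge> T\<close> \<open>h > 0\<close> by (intro cInf_lower) auto
    finally show False by simp
  qed
  then show "\<forall>\<^sub>F t in at_top. dist (y t) 0 < e"
    by (auto simp: eventually_at_top_linorder)
qed

lemma absolutely_integrable_on_halfline:
  fixes g :: "real \<Rightarrow> 'b::euclidean_space"
  assumes cont: "continuous_on {a..} g"
    and bound: "\<And>t. t \<ge> a \<Longrightarrow> integral {a..t} (\<lambda>s. norm (g s)) \<le> B"
  shows "g absolutely_integrable_on {a..}"
proof (rule measurable_bounded_by_integrable_imp_absolutely_integrable)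
  show "g \<in> borel_measurable (lebesgue_on {a..})"
    using cont by (intro continuous_imp_measurable_on_sets_lebesgue) auto
  define f where "f k s = (if s \<in> {a..a + real k} then norm (g s) else 0)" for k s
  have int: "((\<lambda>s. norm (g s)) has_integral integral {a..t} (\<lambda>s. norm (g s))) {a..t}" for t
    by (intro integrable_integral integrable_continuous_real continuous_on_norm
        continuous_on_subset[OF cont]) auto
  have hi: "(f k has_integral integral {a..a + real k} (\<lambda>s. norm (g s))) {a..}" for k
    unfolding f_def by (subst has_integral_restrict) (auto intro: int)
  have "(\<lambda>s. norm (g s)) integrable_on {a..} \<and>
      ((\<lambda>k. integral {a..} (f k)) \<longlonglongrightarrow> integral {a..} (\<lambda>s. norm (g s)))"
  proof (rule monotone_convergence_increasing)
    show "f k integrable_on {a..}" for k using hi by blast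
    show "f k s \<le> f (Suc k) s" if "s \<in> {a..}" for k s by (auto simp: f_def)
    show "(\<lambda>k. f k s) \<longlonglongrightarrow> norm (g s)" if "s \<in> {a..}" for s
    proof (rule tendsto_eventually)
      obtain K where "s - a \<le> real K" using real_arch_simple by blast
      then have "f k s = norm (g s)" if "k \<ge> K" for k
        using that \<open>s \<in> {a..}\<close> by (auto simp: f_def)
      then show "\<forall>\<^sub>F k in sequentially. f k s = norm (g s)"
        by (auto simp: eventually_sequentially)
    qed
    have "norm (integral {a..} (f k)) \<le> B" for k
    proof -
      have "integral {a..} (f k) = integral {a..a + real k} (\<lambda>s. norm (g s))"
        using hi by (rule integral_unique)
      moreover have "0 \<le> integral {a..a + real k} (\<lambda>s. norm (g s))"
        using int by (rule has_integral_nonneg) simp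
      ultimately show ?thesis using bound[of "a + real k"] by simp
    qed
    then show "bounded (range (\<lambda>k. integral {a..} (f k)))" by (auto simp: bounded_iff)
  qed
  then show "(\<lambda>s. norm (g s)) integrable_on {a..}" ..
qed auto

section \<open>Curves satisfying an angle condition under the KL property\<close>

text \<open>A descent curve \<open>z\<close> for \<open>G\<close> whose velocity makes an angle bounded away from a right angle with
  \<open>\<nabla>G\<close>. The gradient flow of \<open>G\<close> is the case \<open>z' = -\<nabla>G(z)\<close>, \<open>\<alpha> = 1\<close>.
  The curve is required to rest at critical points, and to behave in this way only from some
  time \<open>T\<close> on.\<close>

locale angle_trajectory =
  fixes G :: "'b::euclidean_space \<Rightarrow> real" and z z' :: "real \<Rightarrow> 'b" and T \<alpha> :: real
  assumes G_diff: "G differentiable (at w)"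
    and z_deriv: "t \<ge> T \<Longrightarrow> (z has_vector_derivative z' t) (at t within {T..})"
    and z'_cont: "continuous_on {T..} z'"
    and alpha_pos: "\<alpha> > 0"
    and angle: "t \<ge> T \<Longrightarrow> \<alpha> * norm (grad G (z t)) * norm (z' t) \<le> - inner (grad G (z t)) (z' t)"
    and rest: "t \<ge> T \<Longrightarrow> grad G (z t) = 0 \<Longrightarrow> z' t = 0"
begin

lemma G_deriv:
  assumes "t \<ge> T"
  shows "((\<lambda>t. G (z t)) has_real_derivative inner (grad G (z t)) (z' t)) (at t within {T..})"
  by (rule has_real_derivative_along_curve[OF G_diff z_deriv[OF assms]])

lemma at_within_halfline: "t > T \<Longrightarrow> at t within {T..} = at t"
  by (intro at_within_interior) auto

lemma G_noninc: "T \<le> s \<Longrightarrow> s \<le> t \<Longrightarrow> G (z t) \<le> G (z s)"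
proof -
  assume "T \<le> s" "s \<le> t"
  have "inner (grad G (z r)) (z' r) \<le> - 0" if "r \<ge> T" for r
  proof -
    have "0 \<le> \<alpha> * norm (grad G (z r)) * norm (z' r)" using alpha_pos by simp
    with angle[OF that] show ?thesis by linarith
  qed
  with \<open>T \<le> s\<close> have "G (z t) \<le> G (z s) - 0 * (t - s)"
    by (intro decrease_at_rate[OF \<open>s \<le> t\<close>, where W' = "\<lambda>r. inner (grad G (z r)) (z' r)"])
      (auto intro: has_field_derivative_subset[OF G_deriv])
  then show ?thesis by simp
qed

lemma z_cont: "continuous_on {T..} z"
  using z_deriv by (intro continuous_on_vector_derivative) auto

lemma G_cont: "continuous_on {T..} (\<lambda>t. G (z t))"
  using G_deriv by (intro DERIV_continuous_on) auto

text \<open>Both the displacement and the arc length are controlled by any function \<open>\<psi>\<close> that grows at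
  least as fast as the arc length. The bound on the arc length is the bound on the displacement for
  the real curve \<open>u \<mapsto> \<integral>\<^sub>s\<^sup>u \<parallel>z'\<parallel>\<close>.\<close>

lemma length_le_potential_increase:
  assumes "T \<le> s" "s \<le> t" and \<psi>_cont: "continuous_on {s..t} \<psi>"
    and \<psi>_deriv: "\<And>r. s < r \<Longrightarrow> r < t \<Longrightarrow> (\<psi> has_real_derivative \<psi>' r) (at r)"
    and speed: "\<And>r. s < r \<Longrightarrow> r < t \<Longrightarrow> norm (z' r) \<le> \<psi>' r"
  shows "integral {s..t} (\<lambda>r. norm (z' r)) \<le> \<psi> t - \<psi> s" and "norm (z t - z s) \<le> \<psi> t - \<psi> s"
proof -
  have \<psi>v: "(\<psi> has_vector_derivative \<psi>' r) (at r)" if "s < r" "r < t" for r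
    using \<psi>_deriv[OF that] by (simp add: has_real_derivative_iff_has_vector_derivative)
  have "{s..t} \<subseteq> {T..}" using \<open>T \<le> s\<close> by auto
  note z'c = continuous_on_norm[OF continuous_on_subset[OF z'_cont this]]
    and zc = continuous_on_subset[OF z_cont this]
  let ?L = "\<lambda>u. integral {s..u} (\<lambda>r. norm (z' r))"
  have L: "(?L has_vector_derivative norm (z' r)) (at r within {s..t})" if "r \<in> {s..t}" for r
    by (rule integral_has_vector_derivative[OF z'c that])
  have "?L t - ?L s \<le> \<psi> t - \<psi> s \<and> norm (z t - z s) \<le> \<psi> t - \<psi> s"
  proof (cases "s = t")
    case False
    with \<open>s \<le> t\<close> have "s < t" by simp
    have "norm (?L t - ?L s) \<le> \<psi> t - \<psi> s"
    proof (rule differentiable_bound_general[OF \<open>s < t\<close> _ \<psi>_cont _ \<psi>v])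
      show "continuous_on {s..t} ?L" using L by (rule continuous_on_vector_derivative)
      show "(?L has_vector_derivative norm (z' r)) (at r)" if "s < r" "r < t" for r
        using L[of r] that at_within_interior[of r "{s..t}"] by simp
    qed (use speed in auto)
    moreover have "norm (z t - z s) \<le> \<psi> t - \<psi> s"
    proof (rule differentiable_bound_general[OF \<open>s < t\<close> zc \<psi>_cont _ \<psi>v speed])
      show "(z has_vector_derivative z' r) (at r)" if "s < r" "r < t" for r
        using z_deriv[of r] that \<open>T \<le> s\<close> at_within_halfline[of r] by simp
    qed auto
    ultimately show ?thesis by simp
  qed simp
  then show "?L t \<le> \<psi> t - \<psi> s" and "norm (z t - z s) \<le> \<psi> t - \<psi> s" by simp_all
qed

text \<open>While \<open>G\<close> is constant along the curve, the angle condition forces \<open>\<parallel>\<nabla>G(z)\<parallel> \<parallel>z'\<parallel> = 0\<close>,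
  and the curve rests where the first factor vanishes.\<close>

lemma rests_once_G_constant:
  assumes "T \<le> s" and const: "\<And>t. t \<ge> s \<Longrightarrow> G (z t) = e" and "t > s"
  shows "z' t = 0"
proof -
  have "((\<lambda>t. G (z t)) has_real_derivative inner (grad G (z t)) (z' t)) (at t)"
    using G_deriv[of t] at_within_halfline[of t] \<open>T \<le> s\<close> \<open>t > s\<close> by simp
  moreover have "((\<lambda>t. G (z t)) has_real_derivative 0) (at t)"
    using \<open>t > s\<close> const
    by (intro has_field_derivative_transform_within_open[OF DERIV_const[where k = e], where S = "{s<..}"])
      auto
  ultimately have "inner (grad G (z t)) (z' t) = 0" by (rule DERIV_unique)
  with angle[of t] \<open>T \<le> s\<close> \<open>t > s\<close> have "\<alpha> * (norm (grad G (z t)) * norm (z' t)) \<le> 0" by simp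
  then have "norm (grad G (z t)) * norm (z' t) \<le> 0"
    using alpha_pos by (simp add: mult_le_0_iff)
  then have "grad G (z t) = 0 \<or> z' t = 0" by (auto simp: mult_le_0_iff)
  then show ?thesis using rest[of t] \<open>T \<le> s\<close> \<open>t > s\<close> by auto
qed

text \<open>The heart of the argument. Where the gap \<open>e = G(z) - G(z0)\<close> is positive and small and \<open>z\<close> is
  near \<open>z0\<close>, the angle condition and the KL inequality give
  \<open>- (\<theta>(e))' = - \<theta>'(e) \<langle>\<nabla>G(z), z'\<rangle> \<ge> \<alpha> \<theta>'(e) \<parallel>\<nabla>G(z)\<parallel> \<parallel>z'\<parallel> \<ge> \<alpha> \<parallel>z'\<parallel>\<close>,
  so that \<open>\<theta>(e)/\<alpha>\<close> decreases at least as fast as the curve gets longer. This needs the curve in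
  the neighbourhood \<open>U\<close> only at times strictly between \<open>s\<close> and \<open>t\<close>, which is what makes the
  first-exit argument below work. If the gap vanishes at some time, then the curve rests from then
  on and the estimate is trivial.\<close>

lemma length_le_desingularized_gap:
  assumes des: "desingularizing G z0 \<theta>"
    and lim: "((\<lambda>t. G (z t)) \<longlongrightarrow> G z0) at_top"
  obtains U t0 where "open U" and "z0 \<in> U" and "t0 \<ge> T"
    and "((\<lambda>t. \<theta> (G (z t) - G z0)) \<longlongrightarrow> 0) at_top"
    and "\<And>t. t \<ge> t0 \<Longrightarrow> \<theta> (G (z t) - G z0) \<ge> 0"
    and "\<And>s t. \<lbrakk>t0 \<le> s; s \<le> t; \<And>r. s < r \<Longrightarrow> r < t \<Longrightarrow> z r \<in> U\<rbrakk>
      \<Longrightarrow> integral {s..t} (\<lambda>r. norm (z' r)) \<le> 1 / \<alpha> * \<theta> (G (z s) - G z0)"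
    and "\<And>s t. \<lbrakk>t0 \<le> s; s \<le> t; \<And>r. s < r \<Longrightarrow> r < t \<Longrightarrow> z r \<in> U\<rbrakk>
      \<Longrightarrow> norm (z t - z s) \<le> 1 / \<alpha> * \<theta> (G (z s) - G z0)"
proof -
  define e where "e t = G (z t) - G z0" for t
  obtain \<eta> U where "\<eta> > 0" "open U" "z0 \<in> U" and \<theta>_cont: "continuous_on {0..<\<eta>} \<theta>"
    and \<theta>_nonneg: "\<And>s. s \<in> {0..<\<eta>} \<Longrightarrow> \<theta> s \<ge> 0" and "\<theta> 0 = 0"
    and C1: "\<theta> C1_differentiable_on {0<..<\<eta>}"
    and KL: "\<And>w. w \<in> U \<Longrightarrow> G z0 < G w \<Longrightarrow> G w < G z0 + \<eta>
        \<Longrightarrow> deriv \<theta> (G w - G z0) * norm (grad G w) \<ge> 1"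
    using des unfolding desingularizing_def by blast
  have \<theta>_deriv: "(\<theta> has_real_derivative deriv \<theta> v) (at v)" if "v \<in> {0<..<\<eta>}" for v
  proof -
    have "\<theta> differentiable (at v)" using C1 that by (simp add: C1_differentiable_on_eq)
    then show ?thesis
      by (auto simp: real_differentiable_def DERIV_imp_deriv)
  qed
  have e_nonneg: "0 \<le> e t" if "t \<ge> T" for t
  proof -
    have "G z0 \<le> G (z t)"
      using that by (intro tendsto_upperbound[OF lim] eventually_at_top_linorderI[of t] G_noninc) auto
    then show ?thesis by (simp add: e_def)
  qed
  have e_lim: "(e \<longlongrightarrow> 0) at_top"
    using lim unfolding e_def by (simp add: LIM_zero)
  then have "\<forall>\<^sub>F t in at_top. e t < \<eta>"
    using \<open>\<eta> > 0\<close> by (rule order_tendstoD)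
  then obtain t1 where t1: "\<And>t. t \<ge> t1 \<Longrightarrow> e t < \<eta>"
    by (auto simp: eventually_at_top_linorder)
  \<comment> \<open>The gap is nonincreasing, so it either vanishes from some time on or stays positive after \<open>T\<close>.\<close>
  obtain t2 where "t2 \<ge> T" and t2: "(\<forall>t\<ge>t2. e t = 0) \<or> (\<forall>t\<ge>t2. e t > 0)"
  proof (cases "\<exists>t\<ge>T. e t = 0")
    case True
    then obtain t where "t \<ge> T" "e t = 0" by auto
    moreover have "e u = 0" if "u \<ge> t" for u
      using e_nonneg[of u] G_noninc[of t u] that \<open>t \<ge> T\<close> \<open>e t = 0\<close> by (simp add: e_def)
    ultimately show ?thesis using that by blast
  next
    case False
    then have "e t > 0" if "t \<ge> T" for t
      using e_nonneg[OF that] that by (metis order_le_less)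
    then show ?thesis using that by blast
  qed
  define t0 where "t0 = max t1 t2"
  have "t0 \<ge> T" using \<open>t2 \<ge> T\<close> by (simp add: t0_def)
  have e_range: "e t \<in> {0..<\<eta>}" if "t \<ge> t0" for t
    using that e_nonneg t1 \<open>t0 \<ge> T\<close> by (auto simp: t0_def)
  have lim0: "((\<lambda>t. \<theta> (e t)) \<longlongrightarrow> 0) at_top"
    using continuous_on_tendsto_compose[OF \<theta>_cont e_lim] \<open>\<eta> > 0\<close> \<open>\<theta> 0 = 0\<close> e_range
    by (auto simp: eventually_at_top_linorder)
  have nonneg: "\<theta> (e t) \<ge> 0" if "t \<ge> t0" for t
    using e_range[OF that] by (rule \<theta>_nonneg)
  have main: "integral {s..t} (\<lambda>r. norm (z' r)) \<le> 1 / \<alpha> * \<theta> (e s) \<and>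
      norm (z t - z s) \<le> 1 / \<alpha> * \<theta> (e s)"
    if "t0 \<le> s" "s \<le> t" and inU: "\<And>r. s < r \<Longrightarrow> r < t \<Longrightarrow> z r \<in> U" for s t
  proof -
    have "T \<le> s" using \<open>t0 \<ge> T\<close> \<open>t0 \<le> s\<close> by simp
    show ?thesis
    proof (cases "\<forall>u\<ge>t2. e u = 0")
      case True
      have "z' r = 0" if "s < r" for r
        using that True \<open>t0 \<le> s\<close> \<open>T \<le> s\<close>
        by (intro rests_once_G_constant[of s "G z0"]) (auto simp: e_def t0_def)
      with length_le_potential_increase[OF \<open>T \<le> s\<close> \<open>s \<le> t\<close>, of "\<lambda>_. 0" "\<lambda>_. 0"]
      have "integral {s..t} (\<lambda>r. norm (z' r)) \<le> 0" "norm (z t - z s) \<le> 0"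
        by auto
      moreover have "0 \<le> 1 / \<alpha> * \<theta> (e s)"
        using nonneg[OF \<open>t0 \<le> s\<close>] alpha_pos by simp
      ultimately show ?thesis by linarith
    next
      case False
      with t2 have e_pos: "e u > 0" if "u \<ge> s" for u
        using that \<open>t0 \<le> s\<close> by (auto simp: t0_def)
      define \<psi> where "\<psi> r = - (1 / \<alpha> * \<theta> (e r))" for r
      define \<psi>' where "\<psi>' r = - (1 / \<alpha> * (deriv \<theta> (e r) * inner (grad G (z r)) (z' r)))" for r
      have e_cont: "continuous_on {s..t} e"
        unfolding e_def using continuous_on_subset[OF G_cont, of "{s..t}"] \<open>T \<le> s\<close>
        by (intro continuous_intros) auto
      have "continuous_on {s..t} (\<lambda>r. \<theta> (e r))"
        using e_range \<open>t0 \<le> s\<close> by (intro continuous_on_compose2[OF \<theta>_cont e_cont]) auto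
      then have \<psi>_cont: "continuous_on {s..t} \<psi>"
        unfolding \<psi>_def by (intro continuous_intros)
      have \<psi>_deriv: "(\<psi> has_real_derivative \<psi>' r) (at r)" if "s < r" "r < t" for r
      proof -
        have "(e has_real_derivative inner (grad G (z r)) (z' r)) (at r)"
          unfolding e_def using G_deriv[of r] at_within_halfline[of r] that \<open>T \<le> s\<close>
          by (auto intro!: derivative_eq_intros)
        moreover have "(\<theta> has_real_derivative deriv \<theta> (e r)) (at (e r))"
          using that \<open>t0 \<le> s\<close> e_pos[of r] e_range[of r] by (intro \<theta>_deriv) auto
        ultimately have "((\<lambda>r. \<theta> (e r)) has_real_derivative
            deriv \<theta> (e r) * inner (grad G (z r)) (z' r)) (at r)"
          by (rule DERIV_chain2[rotated])
        then show ?thesis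
          unfolding \<psi>_def \<psi>'_def by (intro DERIV_minus DERIV_cmult)
      qed
      have speed: "norm (z' r) \<le> \<psi>' r" if "s < r" "r < t" for r
      proof -
        have KLr: "1 \<le> deriv \<theta> (e r) * norm (grad G (z r))"
          unfolding e_def using that \<open>t0 \<le> s\<close> e_pos[of r] e_range[of r] inU[of r]
          by (intro KL) (auto simp: e_def)
        then have "deriv \<theta> (e r) \<ge> 0"
          by (smt (verit) mult_nonpos_nonneg norm_ge_zero)
        have "\<alpha> * norm (z' r) \<le> (deriv \<theta> (e r) * norm (grad G (z r))) * (\<alpha> * norm (z' r))"
          using mult_right_mono[OF KLr, of "\<alpha> * norm (z' r)"] alpha_pos by simp
        also have "\<dots> = deriv \<theta> (e r) * (\<alpha> * norm (grad G (z r)) * norm (z' r))"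
          by (simp add: mult_ac)
        also have "\<dots> \<le> deriv \<theta> (e r) * (- inner (grad G (z r)) (z' r))"
          using \<open>deriv \<theta> (e r) \<ge> 0\<close> that \<open>T \<le> s\<close> by (intro mult_left_mono angle) auto
        finally show ?thesis
          using alpha_pos by (simp add: \<psi>'_def field_simps)
      qed
      have "\<psi> t \<le> 0"
        using nonneg[of t] alpha_pos \<open>t0 \<le> s\<close> \<open>s \<le> t\<close> by (simp add: \<psi>_def)
      then have "\<psi> t - \<psi> s \<le> 1 / \<alpha> * \<theta> (e s)" by (simp add: \<psi>_def)
      with length_le_potential_increase[OF \<open>T \<le> s\<close> \<open>s \<le> t\<close> \<psi>_cont \<psi>_deriv speed]
      show ?thesis by linarith
    qed
  qed
  show ?thesis
    by (rule that[OF \<open>open U\<close> \<open>z0 \<in> U\<close> \<open>t0 \<ge> T\<close>]) (use lim0 nonneg main in \<open>auto simp: e_def\<close>)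
qed

text \<open>Monotonicity upgrades the convergence of \<open>G(z)\<close> along a sequence of times to full convergence.\<close>

lemma G_tendsto_cluster_value:
  assumes cluster: "\<And>r S. r > 0 \<Longrightarrow> \<exists>t\<ge>S. dist (z t) z0 < r"
  shows "((\<lambda>t. G (z t)) \<longlongrightarrow> G z0) at_top"
proof (rule tendstoI)
  fix r :: real assume "r > 0"
  have "isCont G z0" using G_diff by (rule differentiable_imp_continuous_within)
  then obtain d where "d > 0" and d: "\<And>w. dist w z0 < d \<Longrightarrow> dist (G w) (G z0) < r"
    using \<open>r > 0\<close> by (auto simp: continuous_at_eps_delta dist_norm)
  obtain t1 where "t1 \<ge> T" "dist (z t1) z0 < d" using cluster[OF \<open>d > 0\<close>] by blast
  have "dist (G (z t)) (G z0) < r" if "t \<ge> t1" for t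
  proof -
    obtain t2 where "t2 \<ge> t" "dist (z t2) z0 < d" using cluster[OF \<open>d > 0\<close>] by blast
    then show ?thesis
      using d[of "z t1"] d[of "z t2"] \<open>dist (z t1) z0 < d\<close> G_noninc[of t1 t] G_noninc[of t t2]
        \<open>t1 \<ge> T\<close> that by (simp add: dist_real_def)
  qed
  then show "\<forall>\<^sub>F t in at_top. dist (G (z t)) (G z0) < r"
    by (auto simp: eventually_at_top_linorder)
qed

text \<open>A curve that cannot escape: start it within \<open>r/2\<close> of the cluster point \<open>z0\<close>, at a time when the
  remaining length allowance \<open>\<theta>(G(z) - G(z0))/\<alpha>\<close> is less than \<open>r/2\<close>. At the first exit time
  from the ball of radius \<open>r\<close> it would have travelled less than \<open>r/2\<close>, which is too little. As
  \<open>r\<close> is arbitrary, this confinement is convergence.\<close>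

theorem tendsto_cluster_point:
  assumes des: "desingularizing G z0 \<theta>"
    and cluster: "\<And>r S. r > 0 \<Longrightarrow> \<exists>t\<ge>S. dist (z t) z0 < r"
  shows "(z \<longlongrightarrow> z0) at_top"
proof (rule tendstoI)
  fix \<epsilon> :: real assume "\<epsilon> > 0"
  obtain U t0 where "open U" "z0 \<in> U" "t0 \<ge> T"
    and lim: "((\<lambda>t. \<theta> (G (z t) - G z0)) \<longlongrightarrow> 0) at_top"
    and len: "\<And>s t. \<lbrakk>t0 \<le> s; s \<le> t; \<And>r. s < r \<Longrightarrow> r < t \<Longrightarrow> z r \<in> U\<rbrakk>
      \<Longrightarrow> norm (z t - z s) \<le> 1 / \<alpha> * \<theta> (G (z s) - G z0)"
    by (rule length_le_desingularized_gap[OF des G_tendsto_cluster_value[OF cluster]]) blast+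
  obtain r0 where "r0 > 0" "ball z0 r0 \<subseteq> U"
    using \<open>open U\<close> \<open>z0 \<in> U\<close> by (auto simp: open_contains_ball)
  define r where "r = min r0 \<epsilon>"
  have "r > 0" and ball: "ball z0 r \<subseteq> U"
    using \<open>r0 > 0\<close> \<open>\<epsilon> > 0\<close> \<open>ball z0 r0 \<subseteq> U\<close> by (auto simp: r_def)
  have "((\<lambda>t. 1 / \<alpha> * \<theta> (G (z t) - G z0)) \<longlongrightarrow> 1 / \<alpha> * 0) at_top"
    using lim by (rule tendsto_mult_left)
  then have "\<forall>\<^sub>F t in at_top. 1 / \<alpha> * \<theta> (G (z t) - G z0) < r / 2"
    using \<open>r > 0\<close> by (intro order_tendstoD) auto
  then obtain t1 where t1: "\<And>t. t \<ge> t1 \<Longrightarrow> 1 / \<alpha> * \<theta> (G (z t) - G z0) < r / 2"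
    by (auto simp: eventually_at_top_linorder)
  obtain s where "s \<ge> max t0 t1" and s: "dist (z s) z0 < r / 2"
    using cluster[of "r / 2"] \<open>r > 0\<close> by (metis half_gt_zero)
  have "dist (z t) z0 < r" if "t \<ge> s" for t
  proof (rule ccontr)
    assume "\<not> dist (z t) z0 < r"
    define S where "S = {u \<in> {s..t}. r \<le> dist (z u) z0}"
    have "continuous_on {s..t} (\<lambda>u. dist (z u) z0)"
      using \<open>t0 \<ge> T\<close> \<open>s \<ge> max t0 t1\<close>
      by (intro continuous_intros continuous_on_subset[OF z_cont]) auto
    then have "closed S"
      unfolding S_def by (intro continuous_closed_preimage_constant continuous_on_closed_Collect_le) (auto intro: continuous_intros)
    moreover have "S \<subseteq> {s..t}" by (auto simp: S_def)
    ultimately have "compact S"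
      by (meson bounded_closed_interval bounded_subset compact_eq_bounded_closed)
    moreover have "t \<in> S" using \<open>t \<ge> s\<close> \<open>\<not> dist (z t) z0 < r\<close> by (auto simp: S_def)
    \<comment> \<open>\<open>q\<close> is the first time at which the curve leaves the ball.\<close>
    ultimately obtain q where "q \<in> S" and first: "\<And>u. u \<in> S \<Longrightarrow> q \<le> u"
      using compact_attains_inf[of S] by blast
    have "z u \<in> U" if "s < u" "u < q" for u
    proof -
      have "u \<notin> S" using first that by force
      then have "dist (z u) z0 < r" using that \<open>q \<in> S\<close> by (auto simp: S_def)
      then show ?thesis using ball by (auto simp: dist_commute)
    qed
    then have "norm (z q - z s) \<le> 1 / \<alpha> * \<theta> (G (z s) - G z0)"
      using \<open>q \<in> S\<close> \<open>s \<ge> max t0 t1\<close> by (intro len) (auto simp: S_def)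
    also have "\<dots> < r / 2" using t1[of s] \<open>s \<ge> max t0 t1\<close> by simp
    finally have "dist (z q) z0 < r"
      using dist_triangle[of "z q" z0 "z s"] s by (simp add: dist_norm)
    with \<open>q \<in> S\<close> show False by (simp add: S_def)
  qed
  then show "\<forall>\<^sub>F t in at_top. dist (z t) z0 < \<epsilon>"
    by (force simp: eventually_at_top_linorder r_def)
qed

text \<open>Once the curve stays in \<open>U\<close> for good, the length estimate holds up to any later time; the rate is
  its limit as that time goes to infinity.\<close>

theorem convergence_rate:
  assumes des: "desingularizing G z0 \<theta>" and lim: "(z \<longlongrightarrow> z0) at_top"
  shows "\<forall>\<^sub>F t in at_top. norm (z t - z0) \<le> 1 / \<alpha> * \<theta> (G (z t) - G z0)"
    and "z' absolutely_integrable_on {T..}"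
proof -
  have "isCont G z0" using G_diff by (rule differentiable_imp_continuous_within)
  then have G_lim: "((\<lambda>t. G (z t)) \<longlongrightarrow> G z0) at_top" using lim by (rule isCont_tendsto_compose)
  obtain U t0 where "open U" "z0 \<in> U" "t0 \<ge> T"
    and int: "\<And>s t. \<lbrakk>t0 \<le> s; s \<le> t; \<And>r. s < r \<Longrightarrow> r < t \<Longrightarrow> z r \<in> U\<rbrakk>
      \<Longrightarrow> integral {s..t} (\<lambda>r. norm (z' r)) \<le> 1 / \<alpha> * \<theta> (G (z s) - G z0)"
    and len: "\<And>s t. \<lbrakk>t0 \<le> s; s \<le> t; \<And>r. s < r \<Longrightarrow> r < t \<Longrightarrow> z r \<in> U\<rbrakk>
      \<Longrightarrow> norm (z t - z s) \<le> 1 / \<alpha> * \<theta> (G (z s) - G z0)"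
    by (rule length_le_desingularized_gap[OF des G_lim]) blast+
  obtain t1 where t1: "\<And>t. t \<ge> t1 \<Longrightarrow> z t \<in> U"
    using topological_tendstoD[OF lim \<open>open U\<close> \<open>z0 \<in> U\<close>] by (auto simp: eventually_at_top_linorder)
  define s0 where "s0 = max t0 t1"
  have "norm (z s - z0) \<le> 1 / \<alpha> * \<theta> (G (z s) - G z0)" if "s \<ge> s0" for s
  proof -
    have "((\<lambda>t. norm (z t - z s)) \<longlongrightarrow> norm (z0 - z s)) at_top"
      by (intro tendsto_intros lim)
    moreover have "\<forall>\<^sub>F t in at_top. norm (z t - z s) \<le> 1 / \<alpha> * \<theta> (G (z s) - G z0)"
      using that t1 len[of s] by (intro eventually_at_top_linorderI[of s]) (auto simp: s0_def)
    ultimately have "norm (z0 - z s) \<le> 1 / \<alpha> * \<theta> (G (z s) - G z0)"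
      by (rule tendsto_upperbound) simp
    then show ?thesis by (simp add: norm_minus_commute)
  qed
  then show "\<forall>\<^sub>F t in at_top. norm (z t - z0) \<le> 1 / \<alpha> * \<theta> (G (z t) - G z0)"
    by (auto simp: eventually_at_top_linorder)
  have "s0 \<ge> T" using \<open>t0 \<ge> T\<close> by (simp add: s0_def)
  have "z' absolutely_integrable_on {s0..}"
  proof (rule absolutely_integrable_on_halfline)
    show "continuous_on {s0..} z'" using \<open>s0 \<ge> T\<close> by (intro continuous_on_subset[OF z'_cont]) auto
    show "integral {s0..t} (\<lambda>s. norm (z' s)) \<le> 1 / \<alpha> * \<theta> (G (z s0) - G z0)" if "t \<ge> s0" for t
      using that t1 by (intro int) (auto simp: s0_def)
  qed
  moreover have "z' absolutely_integrable_on {T..s0}"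
    by (intro absolutely_integrable_continuous_real continuous_on_subset[OF z'_cont]) auto
  ultimately have "z' absolutely_integrable_on ({T..s0} \<union> {s0..})"
    by (intro set_integrable_Un) auto
  moreover have "{T..s0} \<union> {s0..} = {T..}" using \<open>s0 \<ge> T\<close> by auto
  ultimately show "z' absolutely_integrable_on {T..}" by simp
qed

end

section \<open>The angle condition for the damped inertial system\<close>

text \<open>The comments of this section write \<open>F\<close> for \<open>vfield \<beta> f \<phi>\<close> and \<open>E\<close> for
  \<open>energy f lam\<close>. The growth of \<open>\<phi>\<close> is prescribed near the origin only, so the comparison of
  \<open>F\<close> with \<open>\<nabla>E\<close> is confined to \<open>\<parallel>u\<parallel> \<le> \<epsilon>\<close>.\<close>

locale inertial_system =
  fixes f \<phi> :: "'a::euclidean_space \<Rightarrow> real" and \<beta> \<gamma> \<delta> \<epsilon> :: real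
  assumes beta_nonneg: "\<beta> \<ge> 0"
    and f_convex: "convex_on UNIV f" and f_C2: "twice_cont_differentiable f"
    and \<phi>_convex: "convex_on UNIV \<phi>" and \<phi>_zero: "\<phi> 0 = 0" and \<phi>_diff: "\<phi> differentiable (at u)"
    and \<gamma>_pos: "\<gamma> > 0" and \<delta>_pos: "\<delta> > 0"
    and \<phi>_ge: "norm u \<le> \<epsilon> \<Longrightarrow> \<gamma> * (norm u)\<^sup>2 \<le> \<phi> u"
    and grad_\<phi>_le: "norm u \<le> \<epsilon> \<Longrightarrow> norm (grad \<phi> u) \<le> \<delta> * norm u"
begin

lemma f_diff: "f differentiable (at x)" and grad_f_diff: "grad f differentiable (at x)"
  and hess_cont: "continuous_on UNIV (hess f)"
  using f_C2 by (auto simp: twice_cont_differentiable_def)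

lemma grad_f_cont: "continuous_on UNIV (grad f)"
  using grad_f_diff by (auto intro: continuous_at_imp_continuous_on differentiable_imp_continuous_within)

lemma energy_diff: "energy f lam differentiable (at z)"
  using energy_has_derivative[OF f_diff grad_f_diff] by (cases z) (auto simp: differentiable_def)

text \<open>The tangent inequality for \<open>\<phi>\<close> at \<open>u\<close>, read off at the origin.\<close>

lemma \<phi>_le_inner_grad: "\<phi> u \<le> inner u (grad \<phi> u)"
  using convex_above_tangent_plane[OF \<phi>_convex \<phi>_diff, of u 0] \<phi>_zero
  by (simp add: inner_commute)

lemma hess_nonneg: "0 \<le> inner (blinfun_apply (hess f x) u) u"
  by (rule convex_hess_nonneg[OF f_convex f_diff grad_f_diff])

lemma hess_bounded_on_ball:
  obtains M where "M \<ge> 0" and "\<And>x. norm x \<le> R \<Longrightarrow> norm (hess f x) \<le> M"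
proof -
  have "compact (hess f ` cball 0 R)"
    by (intro compact_continuous_image continuous_on_subset[OF hess_cont]) auto
  then obtain M where "\<And>y. y \<in> hess f ` cball 0 R \<Longrightarrow> norm y \<le> M" "M > 0"
    by (metis bounded_pos compact_imp_bounded)
  then show ?thesis by (intro that[of M]) auto
qed

lemma inner_grad_energy_vfield:
  "inner (grad (energy f lam) (x, u)) (vfield \<beta> f \<phi> (x, u))
     = inner u (grad \<phi> u) + \<beta> * inner (blinfun_apply (hess f x) u) u
       + lam * ((norm (grad f x))\<^sup>2 + inner (grad f x) (grad \<phi> u)
          + \<beta> * inner (grad f x) (blinfun_apply (hess f x) u)
          - inner (blinfun_apply (hess f x) u) u)"
  by (simp add: vfield_def inner_grad_energy[OF f_diff grad_f_diff] blinfun.minus_right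
      inner_add_right inner_commute power2_norm_eq_inner algebra_simps)

text \<open>Test the derivative of the energy with its own gradient \<open>(h, k)\<close>: this gives \<open>\<parallel>\<nabla>E\<parallel>\<^sup>2\<close> as a
  sum of inner products, each at most \<open>\<parallel>\<nabla>E\<parallel>\<close> times a multiple of \<open>\<parallel>u\<parallel>\<close> or
  \<open>\<parallel>\<nabla>f(x)\<parallel>\<close>.\<close>

lemma norm_grad_energy_le:
  assumes "norm (hess f x) \<le> M" and "lam \<ge> 0" and "M \<ge> 0"
  shows "norm (grad (energy f lam) (x, u)) \<le> (1 + lam * (M + 1)) * (norm u + norm (grad f x))"
proof -
  obtain h k where hk: "grad (energy f lam) (x, u) = (h, k)" by fastforce
  let ?n = "norm (grad (energy f lam) (x, u))"
  have "norm h \<le> ?n" and k: "norm k \<le> ?n"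
    by (simp_all add: hk norm_fst_le norm_snd_le)
  have "norm (blinfun_apply (hess f x) h) \<le> norm (hess f x) * norm h" by (rule norm_blinfun)
  also have "\<dots> \<le> M * ?n" using assms \<open>norm h \<le> ?n\<close> by (intro mult_mono) auto
  finally have Hh: "norm (blinfun_apply (hess f x) h) \<le> M * ?n" .
  have "inner u k \<le> norm u * ?n"
    using norm_cauchy_schwarz[of u k] mult_left_mono[OF k norm_ge_zero[of u]] by simp
  moreover have "inner (grad f x) h \<le> norm (grad f x) * ?n"
    using norm_cauchy_schwarz[of "grad f x" h] mult_left_mono[OF \<open>norm h \<le> ?n\<close> norm_ge_zero[of "grad f x"]]
    by simp
  moreover have "lam * inner (blinfun_apply (hess f x) h) u \<le> lam * (M * ?n * norm u)"
    using norm_cauchy_schwarz[of "blinfun_apply (hess f x) h" u] mult_right_mono[OF Hh norm_ge_zero[of u]]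
      \<open>lam \<ge> 0\<close> by (intro mult_left_mono) auto
  moreover have "lam * inner (grad f x) k \<le> lam * (norm (grad f x) * ?n)"
    using norm_cauchy_schwarz[of "grad f x" k] mult_left_mono[OF k norm_ge_zero[of "grad f x"]]
      \<open>lam \<ge> 0\<close> by (intro mult_left_mono) auto
  moreover have "?n * ?n = inner u k + inner (grad f x) h
         + lam * (inner (blinfun_apply (hess f x) h) u + inner (grad f x) k)"
    using inner_grad_energy[OF f_diff grad_f_diff, of lam x u h k]
    by (simp add: hk flip: power2_norm_eq_inner power2_eq_square)
  ultimately have "?n * ?n \<le> norm u * ?n + norm (grad f x) * ?n
      + lam * (M * ?n * norm u) + lam * (norm (grad f x) * ?n)"
    by (simp add: distrib_left)
  also have "\<dots> = (norm u + norm (grad f x) + lam * (M * norm u + norm (grad f x))) * ?n"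
    by (simp add: algebra_simps)
  finally have "?n \<le> norm u + norm (grad f x) + lam * (M * norm u + norm (grad f x))"
    using assms by (cases "?n = 0") auto
  also have "lam * (M * norm u + norm (grad f x)) \<le> lam * ((M + 1) * (norm u + norm (grad f x)))"
    using assms by (intro mult_left_mono) (auto simp: algebra_simps)
  finally show ?thesis by (simp add: algebra_simps)
qed

lemma norm_vfield_le:
  assumes "norm (hess f x) \<le> M" and "norm u \<le> \<epsilon>" and "M \<ge> 0"
  shows "norm (vfield \<beta> f \<phi> (x, u)) \<le> (1 + (\<delta> + \<beta> * M)) * (norm u + norm (grad f x))"
proof -
  have "norm (blinfun_apply (hess f x) u) \<le> M * norm u"
    using norm_blinfun[of "hess f x" u] mult_right_mono[OF assms(1) norm_ge_zero[of u]] by simp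
  then have "norm (\<beta> *\<^sub>R blinfun_apply (hess f x) u) \<le> \<beta> * (M * norm u)"
    using beta_nonneg by (auto intro: mult_left_mono)
  then have "norm (grad \<phi> u + grad f x + \<beta> *\<^sub>R blinfun_apply (hess f x) u)
      \<le> \<delta> * norm u + norm (grad f x) + \<beta> * (M * norm u)"
    using grad_\<phi>_le[OF assms(2)] by (intro norm_triangle_le add_mono order_refl) auto
  then have "norm (vfield \<beta> f \<phi> (x, u)) \<le> norm u + (\<delta> * norm u + norm (grad f x) + \<beta> * (M * norm u))"
    unfolding vfield_def using norm_Pair_le[of "- u"] by (smt (verit) case_prod_conv norm_minus_cancel)
  also have "\<dots> \<le> (1 + (\<delta> + \<beta> * M)) * (norm u + norm (grad f x))"
    using \<delta>_pos beta_nonneg \<open>M \<ge> 0\<close> by (simp add: algebra_simps)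
  finally show ?thesis .
qed

text \<open>The damping contributes \<open>\<gamma> \<parallel>u\<parallel>\<^sup>2\<close>, the perturbation of the energy contributes
  \<open>lam \<parallel>\<nabla>f(x)\<parallel>\<^sup>2\<close>, and the Hessian damping has the right sign. The remaining terms carry
  the factor \<open>lam\<close> and are quadratic in \<open>(\<parallel>u\<parallel>, \<parallel>\<nabla>f(x)\<parallel>)\<close> without a
  \<open>\<parallel>\<nabla>f(x)\<parallel>\<^sup>2\<close> part; Young's inequality gives half of the gradient term to the mixed ones, and
  what is left in \<open>\<parallel>u\<parallel>\<^sup>2\<close> is absorbed by the damping when \<open>lam\<close> is small.\<close>

lemma energy_dissipation_ge:
  assumes H: "norm (hess f x) \<le> M" and u: "norm u \<le> \<epsilon>" and "lam \<ge> 0"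
    and small: "lam * (M + (\<delta> + \<beta> * M)\<^sup>2 / 2 + 1 / 2) \<le> \<gamma>"
  shows "lam / 2 * ((norm u)\<^sup>2 + (norm (grad f x))\<^sup>2)
      \<le> inner (grad (energy f lam) (x, u)) (vfield \<beta> f \<phi> (x, u))"
proof -
  let ?H = "blinfun_apply (hess f x) u" and ?g = "norm (grad f x)" and ?X = "norm u"
  let ?K = "\<delta> + \<beta> * M"
  have Hu: "norm ?H \<le> M * ?X"
    using norm_blinfun[of "hess f x" u] mult_right_mono[OF H norm_ge_zero[of u]] by simp
  have "\<gamma> * ?X\<^sup>2 \<le> inner u (grad \<phi> u)"
    using \<phi>_ge[OF u] \<phi>_le_inner_grad[of u] by simp
  moreover have "0 \<le> \<beta> * inner ?H u" using beta_nonneg hess_nonneg by simp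
  moreover
  have "lam * (?g\<^sup>2 / 2 - (?K\<^sup>2 / 2 + M) * ?X\<^sup>2) \<le> lam * (?g\<^sup>2 + inner (grad f x) (grad \<phi> u)
          + \<beta> * inner (grad f x) ?H - inner ?H u)"
  proof (rule mult_left_mono[OF _ \<open>lam \<ge> 0\<close>])
    have "inner ?H u \<le> norm ?H * ?X" by (rule norm_cauchy_schwarz)
    also have "\<dots> \<le> M * ?X\<^sup>2" using mult_right_mono[OF Hu norm_ge_zero[of u]]
      by (simp add: power2_eq_square mult_ac)
    finally have 1: "inner ?H u \<le> M * ?X\<^sup>2" .
    have "- inner (grad f x) (grad \<phi> u) \<le> ?g * norm (grad \<phi> u)"
      using norm_cauchy_schwarz[of "- grad f x" "grad \<phi> u"] by simp
    also have "\<dots> \<le> ?g * (\<delta> * ?X)" using grad_\<phi>_le[OF u] by (intro mult_left_mono) auto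
    finally have 2: "- inner (grad f x) (grad \<phi> u) \<le> ?g * (\<delta> * ?X)" .
    have "- inner (grad f x) ?H \<le> ?g * norm ?H"
      using norm_cauchy_schwarz[of "- grad f x" ?H] by simp
    also have "\<dots> \<le> ?g * (M * ?X)" using Hu by (intro mult_left_mono) auto
    finally have "\<beta> * (- inner (grad f x) ?H) \<le> \<beta> * (?g * (M * ?X))"
      using beta_nonneg by (rule mult_left_mono)
    then have 3: "- (\<beta> * inner (grad f x) ?H) \<le> \<beta> * (?g * (M * ?X))" by simp
    have "K * (?g * ?X) \<le> ?g\<^sup>2 / 2 + K\<^sup>2 / 2 * ?X\<^sup>2" for K
      using sum_squares_bound[of ?g "K * ?X"] by (simp add: power_mult_distrib mult_ac)
    from this[of ?K]
    have "?g * (\<delta> * ?X) + \<beta> * (?g * (M * ?X)) \<le> ?g\<^sup>2 / 2 + ?K\<^sup>2 / 2 * ?X\<^sup>2"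
      unfolding distrib_right by (simp only: mult_ac)
    with 1 2 3 show "?g\<^sup>2 / 2 - (?K\<^sup>2 / 2 + M) * ?X\<^sup>2 \<le> ?g\<^sup>2 + inner (grad f x) (grad \<phi> u)
          + \<beta> * inner (grad f x) ?H - inner ?H u"
      unfolding distrib_right by linarith
  qed
  moreover have "lam * (M + ?K\<^sup>2 / 2 + 1 / 2) * ?X\<^sup>2 \<le> \<gamma> * ?X\<^sup>2"
    using small by (intro mult_right_mono) auto
  ultimately show ?thesis
    unfolding inner_grad_energy_vfield by (simp add: algebra_simps)
qed

text \<open>The dissipation dominates \<open>\<parallel>u\<parallel>\<^sup>2 + \<parallel>\<nabla>f(x)\<parallel>\<^sup>2\<close>, while both \<open>\<parallel>\<nabla>E\<parallel>\<close> and
  \<open>\<parallel>F\<parallel>\<close> are at most a multiple of \<open>\<parallel>u\<parallel> + \<parallel>\<nabla>f(x)\<parallel>\<close>. The angle condition is the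
  quotient of these bounds. The coercivity itself is kept as well, as it is what drives
  \<open>\<nabla>f(x(t))\<close> to zero along a trajectory.\<close>

theorem angle_condition:
  "\<forall>\<^sub>F lam in at_right 0. \<exists>\<alpha>>0. \<forall>z \<in> cball 0 R \<times> cball 0 \<epsilon>.
      inner (grad (energy f lam) z) (vfield \<beta> f \<phi> z)
        \<ge> \<alpha> * norm (grad (energy f lam) z) * norm (vfield \<beta> f \<phi> z) \<and>
      inner (grad (energy f lam) z) (vfield \<beta> f \<phi> z)
        \<ge> lam / 2 * ((norm (snd z))\<^sup>2 + (norm (grad f (fst z)))\<^sup>2)"
proof -
  obtain M where "M \<ge> 0" and M: "\<And>x. norm x \<le> R \<Longrightarrow> norm (hess f x) \<le> M"
    by (rule hess_bounded_on_ball[where R = R]) blast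
  define K where "K = \<delta> + \<beta> * M"
  have "K \<ge> 0" using \<delta>_pos beta_nonneg \<open>M \<ge> 0\<close> by (simp add: K_def)
  define D where "D = M + K\<^sup>2 / 2 + 1 / 2"
  have "D > 0" using \<open>M \<ge> 0\<close> by (simp add: D_def add_nonneg_pos)
  show ?thesis
  proof (rule eventually_at_rightI)
    show "0 < \<gamma> / D" using \<gamma>_pos \<open>D > 0\<close> by simp
    fix lam assume "lam \<in> {0<..<\<gamma> / D}"
    then have "lam > 0" and small: "lam * D \<le> \<gamma>" using \<open>D > 0\<close> by (auto simp: field_simps)
    define A where "A = 1 + lam * (M + 1)"
    have "A > 0" using \<open>lam > 0\<close> \<open>M \<ge> 0\<close> by (simp add: A_def add_pos_nonneg)
    \<comment> \<open>\<open>A\<close> and \<open>1 + K\<close> bound \<open>\<nabla>E\<close> and \<open>F\<close>; of the factor 4, one 2 comes from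
      \<open>(a + b)\<^sup>2 \<le> 2 (a\<^sup>2 + b\<^sup>2)\<close> and the other from \<open>lam / 2\<close> in the dissipation.\<close>
    define \<alpha> where "\<alpha> = lam / (4 * (A * (1 + K)))"
    have "\<alpha> > 0" using \<open>lam > 0\<close> \<open>A > 0\<close> \<open>K \<ge> 0\<close> by (simp add: \<alpha>_def)
    moreover have "\<alpha> * norm (grad (energy f lam) (x, u)) * norm (vfield \<beta> f \<phi> (x, u))
          \<le> inner (grad (energy f lam) (x, u)) (vfield \<beta> f \<phi> (x, u)) \<and>
        lam / 2 * ((norm u)\<^sup>2 + (norm (grad f x))\<^sup>2)
          \<le> inner (grad (energy f lam) (x, u)) (vfield \<beta> f \<phi> (x, u))"
      if x: "norm x \<le> R" and u: "norm u \<le> \<epsilon>" for x u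
    proof -
      let ?X = "norm u" and ?g = "norm (grad f x)"
      have low: "lam / 2 * (?X\<^sup>2 + ?g\<^sup>2) \<le> inner (grad (energy f lam) (x, u)) (vfield \<beta> f \<phi> (x, u))"
        using energy_dissipation_ge[OF M[OF x] u] \<open>lam > 0\<close> small by (simp add: D_def K_def)
      have "norm (grad (energy f lam) (x, u)) * norm (vfield \<beta> f \<phi> (x, u))
          \<le> (A * (?X + ?g)) * ((1 + K) * (?X + ?g))"
        using norm_grad_energy_le[OF M[OF x], of lam u] norm_vfield_le[OF M[OF x] u] \<open>M \<ge> 0\<close>
          \<open>lam > 0\<close> \<open>A > 0\<close> by (intro mult_mono) (auto simp: A_def K_def)
      also have "\<dots> = A * (1 + K) * (?X + ?g)\<^sup>2" by (simp add: power2_eq_square mult_ac)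
      also have "\<dots> \<le> A * (1 + K) * (2 * (?X\<^sup>2 + ?g\<^sup>2))"
      proof (rule mult_left_mono)
        have "0 \<le> (?X - ?g)\<^sup>2" by simp
        then show "(?X + ?g)\<^sup>2 \<le> 2 * (?X\<^sup>2 + ?g\<^sup>2)" by (simp add: power2_sum power2_diff)
      qed (use \<open>A > 0\<close> \<open>K \<ge> 0\<close> in simp)
      finally have "\<alpha> * (norm (grad (energy f lam) (x, u)) * norm (vfield \<beta> f \<phi> (x, u)))
          \<le> \<alpha> * (A * (1 + K) * (2 * (?X\<^sup>2 + ?g\<^sup>2)))"
        using \<open>\<alpha> > 0\<close> by (intro mult_left_mono) auto
      also have "\<dots> = \<alpha> * (4 * (A * (1 + K))) / 2 * (?X\<^sup>2 + ?g\<^sup>2)"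
        by simp
      also have "\<alpha> * (4 * (A * (1 + K))) = lam"
        using \<open>A > 0\<close> \<open>K \<ge> 0\<close> by (simp add: \<alpha>_def)
      finally show ?thesis using low by (simp add: mult.assoc)
    qed
    ultimately show "\<exists>\<alpha>>0. \<forall>z \<in> cball 0 R \<times> cball 0 \<epsilon>.
      inner (grad (energy f lam) z) (vfield \<beta> f \<phi> z)
        \<ge> \<alpha> * norm (grad (energy f lam) z) * norm (vfield \<beta> f \<phi> z) \<and>
      inner (grad (energy f lam) z) (vfield \<beta> f \<phi> z)
        \<ge> lam / 2 * ((norm (snd z))\<^sup>2 + (norm (grad f (fst z)))\<^sup>2)"
      by (intro exI[of _ \<alpha>]) auto
  qed
qed

end

section \<open>Asymptotics of bounded trajectories\<close>

locale inertial_trajectory = inertial_system f \<phi> \<beta> \<gamma> \<delta> \<epsilon>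
  for f \<phi> :: "'a::euclidean_space \<Rightarrow> real" and \<beta> \<gamma> \<delta> \<epsilon> :: real +
  fixes x x' x'' :: "real \<Rightarrow> 'a" and p c R :: real
  assumes \<epsilon>_pos: "\<epsilon> > 0" and f_below: "bdd_below (range f)"
    and grad_\<phi>_cont: "continuous_on UNIV (grad \<phi>)"
    and p_nonneg: "p \<ge> 0" and c_pos: "c > 0" and \<phi>_growth: "\<phi> u \<ge> c * norm u powr p"
    and x_deriv: "t \<ge> 0 \<Longrightarrow> (x has_vector_derivative x' t) (at t within {0..})"
    and x'_deriv: "t \<ge> 0 \<Longrightarrow> (x' has_vector_derivative x'' t) (at t within {0..})"
    and motion: "t \<ge> 0 \<Longrightarrow> x'' t + grad \<phi> (x' t) + \<beta> *\<^sub>R blinfun_apply (hess f (x t)) (x' t)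
                  + grad f (x t) = 0"
    and x_in_ball: "t \<ge> 0 \<Longrightarrow> norm (x t) \<le> R"
begin

lemma phase_deriv:
  "t \<ge> 0 \<Longrightarrow> ((\<lambda>t. (x t, x' t)) has_vector_derivative (x' t, x'' t)) (at t within {0..})"
  by (intro has_vector_derivative_Pair x_deriv x'_deriv)

lemma phase_velocity: "t \<ge> 0 \<Longrightarrow> (x' t, x'' t) = - vfield \<beta> f \<phi> (x t, x' t)"
  using motion[of t] by (simp add: vfield_def eq_neg_iff_add_eq_0 algebra_simps)

lemma acceleration:
  "t \<ge> 0 \<Longrightarrow> x'' t = - (grad \<phi> (x' t) + \<beta> *\<^sub>R blinfun_apply (hess f (x t)) (x' t) + grad f (x t))"
  using motion[of t] by (simp only: eq_neg_iff_add_eq_0 add.assoc)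

lemma x_cont: "continuous_on {0..} x" and x'_cont: "continuous_on {0..} x'"
  using x_deriv x'_deriv by (auto intro: continuous_on_vector_derivative)

lemma x''_cont: "continuous_on {0..} x''"
proof -
  have "continuous_on {0..} (\<lambda>t. - (grad \<phi> (x' t) + \<beta> *\<^sub>R blinfun_apply (hess f (x t)) (x' t)
      + grad f (x t)))"
    by (intro continuous_intros blinfun.continuous_on x'_cont
        continuous_on_compose2[OF grad_\<phi>_cont x'_cont] continuous_on_compose2[OF hess_cont x_cont]
        continuous_on_compose2[OF grad_f_cont x_cont]) auto
  then show ?thesis
    by (rule continuous_on_eq) (simp add: acceleration)
qed

lemma energy_deriv:
  assumes "t \<ge> 0"
  shows "((\<lambda>t. energy f lam (x t, x' t)) has_real_derivative
     - inner (grad (energy f lam) (x t, x' t)) (vfield \<beta> f \<phi> (x t, x' t))) (at t within {0..})"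
  using has_real_derivative_along_curve[OF energy_diff phase_deriv[OF assms]]
  by (simp add: phase_velocity[OF assms])

text \<open>For \<open>lam = 0\<close> the energy is the mechanical one, and it is dissipated at every velocity, not
  only at small ones. It therefore controls the trajectory before the angle condition applies.\<close>

lemma energy_zero_dissipation:
  "- inner (grad (energy f 0) (x t, x' t)) (vfield \<beta> f \<phi> (x t, x' t)) \<le> - (c * norm (x' t) powr p)"
proof -
  have "0 \<le> \<beta> * inner (blinfun_apply (hess f (x t)) (x' t)) (x' t)"
    using beta_nonneg hess_nonneg by simp
  then show ?thesis
    using \<phi>_le_inner_grad[of "x' t"] \<phi>_growth[of "x' t"] by (simp add: inner_grad_energy_vfield)
qed

lemma velocity_bounded: obtains V where "\<And>t. t \<ge> 0 \<Longrightarrow> norm (x' t) \<le> V"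
proof -
  obtain m where m: "\<And>y. m \<le> f y" using f_below by (auto simp: bdd_below_def)
  let ?W = "\<lambda>t. energy f 0 (x t, x' t)"
  have "(norm (x' t))\<^sup>2 \<le> 2 * (?W 0 - m)" if "t \<ge> 0" for t
  proof -
    have "- inner (grad (energy f 0) (x r, x' r)) (vfield \<beta> f \<phi> (x r, x' r)) \<le> - 0" for r
    proof -
      have "0 \<le> c * norm (x' r) powr p" using c_pos by simp
      with energy_zero_dissipation[of r] show ?thesis by linarith
    qed
    then have "?W t \<le> ?W 0 - 0 * (t - 0)"
      using that by (intro decrease_at_rate[OF that,
          where W' = "\<lambda>r. - inner (grad (energy f 0) (x r, x' r)) (vfield \<beta> f \<phi> (x r, x' r))"])
        (auto intro: has_field_derivative_subset[OF energy_deriv])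
    then show ?thesis using m[of "x t"] by (simp add: energy_def)
  qed
  then have "norm (x' t) \<le> sqrt (2 * (?W 0 - m))" if "t \<ge> 0" for t
    using that by (simp add: real_le_rsqrt)
  then show ?thesis by (rule that)
qed

lemma velocity_lipschitz: obtains L where "L-lipschitz_on {0..} x'"
proof -
  obtain V where V: "\<And>t. t \<ge> 0 \<Longrightarrow> norm (x' t) \<le> V" by (rule velocity_bounded) blast
  let ?k = "\<lambda>(y, u). - (grad \<phi> u + \<beta> *\<^sub>R blinfun_apply (hess f y) u + grad f y)"
  have "continuous_on (cball 0 R \<times> cball 0 V) ?k"
    unfolding case_prod_beta
    by (intro continuous_intros blinfun.continuous_on continuous_on_compose2[OF grad_\<phi>_cont]
        continuous_on_compose2[OF hess_cont] continuous_on_compose2[OF grad_f_cont]) auto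
  then have "compact (?k ` (cball 0 R \<times> cball 0 V))"
    by (rule compact_continuous_image) (intro compact_Times compact_cball)
  then obtain L where L: "\<And>w. w \<in> ?k ` (cball 0 R \<times> cball 0 V) \<Longrightarrow> norm w \<le> L"
    by (meson bounded_iff compact_imp_bounded)
  have "norm (x'' t) \<le> L" if "t \<ge> 0" for t
  proof (rule L)
    have "x'' t = ?k (x t, x' t)"
      using acceleration[OF that] by simp
    then show "x'' t \<in> ?k ` (cball 0 R \<times> cball 0 V)"
      using V[OF that] x_in_ball[OF that] by (intro image_eqI) auto
  qed
  then show ?thesis using lipschitz_if_speed_bounded[OF x'_deriv] that by blast
qed

lemma velocity_tendsto_zero: "(x' \<longlongrightarrow> 0) at_top"
proof -
  obtain L where "L-lipschitz_on {0..} x'" by (rule velocity_lipschitz)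
  moreover obtain m where m: "\<And>y. m \<le> f y" using f_below by (auto simp: bdd_below_def)
  have "m \<le> energy f 0 (x t, x' t)" for t
    using m[of "x t"] by (simp add: energy_def add_increasing)
  ultimately show ?thesis
    by (intro tendsto_zero_if_dissipated[OF energy_deriv energy_zero_dissipation c_pos p_nonneg])
qed

lemma gradient_lipschitz: obtains L where "L-lipschitz_on {0..} (\<lambda>t. grad f (x t))"
proof -
  obtain V where V: "\<And>t. t \<ge> 0 \<Longrightarrow> norm (x' t) \<le> V" by (rule velocity_bounded) blast
  obtain M where "M \<ge> 0" and M: "\<And>y. norm y \<le> R \<Longrightarrow> norm (hess f y) \<le> M"
    by (rule hess_bounded_on_ball[where R = R]) blast
  have "(M * V)-lipschitz_on {0..} (\<lambda>t. grad f (x t))"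
  proof (rule lipschitz_if_speed_bounded)
    fix t :: real assume "t \<ge> 0"
    have "((\<lambda>t. grad f (x t)) has_derivative (\<lambda>h. blinfun_apply (hess f (x t)) (h *\<^sub>R x' t)))
        (at t within {0..})"
      using has_derivative_compose[OF x_deriv[OF \<open>t \<ge> 0\<close>, unfolded has_vector_derivative_def]
          has_derivative_grad[OF grad_f_diff]] .
    then show "((\<lambda>t. grad f (x t)) has_vector_derivative blinfun_apply (hess f (x t)) (x' t))
        (at t within {0..})"
      by (simp add: has_vector_derivative_def blinfun.scaleR_right)
    have "norm (blinfun_apply (hess f (x t)) (x' t)) \<le> norm (hess f (x t)) * norm (x' t)"
      by (rule norm_blinfun)
    also have "\<dots> \<le> M * V"
      using M[OF x_in_ball[OF \<open>t \<ge> 0\<close>]] V[OF \<open>t \<ge> 0\<close>] \<open>M \<ge> 0\<close> by (intro mult_mono) auto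
    finally show "norm (blinfun_apply (hess f (x t)) (x' t)) \<le> M * V" .
  qed
  then show ?thesis by (rule that)
qed

lemma velocity_eventually_small: obtains T where "T \<ge> 0" and "\<And>t. t \<ge> T \<Longrightarrow> norm (x' t) \<le> \<epsilon>"
proof -
  obtain T where "\<And>t. t \<ge> T \<Longrightarrow> norm (x' t) < \<epsilon>"
    using tendstoD[OF velocity_tendsto_zero \<epsilon>_pos] by (auto simp: eventually_at_top_linorder)
  then show ?thesis by (intro that[of "max 0 T"]) (auto intro: less_imp_le)
qed

context
  fixes lam \<alpha> :: real
  assumes lam_pos: "lam > 0" and \<alpha>_pos: "\<alpha> > 0"
    and angle: "z \<in> cball 0 R \<times> cball 0 \<epsilon> \<Longrightarrow>
      inner (grad (energy f lam) z) (vfield \<beta> f \<phi> z)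
        \<ge> \<alpha> * norm (grad (energy f lam) z) * norm (vfield \<beta> f \<phi> z)"
    and coercive: "z \<in> cball 0 R \<times> cball 0 \<epsilon> \<Longrightarrow>
      inner (grad (energy f lam) z) (vfield \<beta> f \<phi> z)
        \<ge> lam / 2 * ((norm (snd z))\<^sup>2 + (norm (grad f (fst z)))\<^sup>2)"
begin

text \<open>With \<open>lam > 0\<close> the energy also dissipates \<open>\<parallel>\<nabla>f(x)\<parallel>\<^sup>2\<close>, once the velocity is so small
  that the trajectory has entered the region of the coercivity estimate.\<close>

lemma gradient_tendsto_zero: "((\<lambda>t. grad f (x t)) \<longlongrightarrow> 0) at_top"
proof -
  obtain T where "T \<ge> 0" and T: "\<And>t. t \<ge> T \<Longrightarrow> norm (x' t) \<le> \<epsilon>"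
    by (rule velocity_eventually_small) blast
  obtain L where L: "L-lipschitz_on {0..} (\<lambda>t. grad f (x t))" by (rule gradient_lipschitz)
  obtain m where m: "\<And>y. m \<le> f y" using f_below by (auto simp: bdd_below_def)
  have "compact (grad f ` cball 0 R)"
    by (intro compact_continuous_image continuous_on_subset[OF grad_f_cont]) auto
  then obtain B where B: "\<And>y. y \<in> grad f ` cball 0 R \<Longrightarrow> norm y \<le> B"
    by (meson bounded_iff compact_imp_bounded)
  show ?thesis
  proof (rule tendsto_zero_if_dissipated[where W = "\<lambda>t. energy f lam (x t, x' t)" and T = T and p = 2])
    fix t assume "t \<ge> T"
    with \<open>T \<ge> 0\<close> have "t \<ge> 0" by simp
    show "((\<lambda>t. energy f lam (x t, x' t)) has_real_derivative
       - inner (grad (energy f lam) (x t, x' t)) (vfield \<beta> f \<phi> (x t, x' t))) (at t within {T..})"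
      using \<open>T \<ge> 0\<close> by (intro has_field_derivative_subset[OF energy_deriv[OF \<open>t \<ge> 0\<close>]]) auto
    have "lam / 2 * (norm (grad f (x t)))\<^sup>2
        \<le> lam / 2 * ((norm (x' t))\<^sup>2 + (norm (grad f (x t)))\<^sup>2)"
      using lam_pos by (intro mult_left_mono) auto
    also have "\<dots> \<le> inner (grad (energy f lam) (x t, x' t)) (vfield \<beta> f \<phi> (x t, x' t))"
      using coercive[of "(x t, x' t)"] x_in_ball[OF \<open>t \<ge> 0\<close>] T[OF \<open>t \<ge> T\<close>] by simp
    finally show "- inner (grad (energy f lam) (x t, x' t)) (vfield \<beta> f \<phi> (x t, x' t))
        \<le> - (lam / 2 * norm (grad f (x t)) powr 2)" by simp
    have "- inner (grad f (x t)) (x' t) \<le> norm (grad f (x t)) * norm (x' t)"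
      using norm_cauchy_schwarz[of "- grad f (x t)" "x' t"] by simp
    also have "\<dots> \<le> B * \<epsilon>"
      using B[of "grad f (x t)"] x_in_ball[OF \<open>t \<ge> 0\<close>] T[OF \<open>t \<ge> T\<close>]
        order_trans[OF norm_ge_zero B[of "grad f (x t)"]]
      by (intro mult_mono) auto
    finally have "lam * (- inner (grad f (x t)) (x' t)) \<le> lam * (B * \<epsilon>)"
      using lam_pos by (intro mult_left_mono) auto
    moreover have "0 \<le> (norm (x' t))\<^sup>2 / 2" by simp
    ultimately show "m - lam * (B * \<epsilon>) \<le> energy f lam (x t, x' t)"
      using m[of "x t"] unfolding energy_def case_prod_conv mult_minus_right by linarith
    qed (use lam_pos \<open>T \<ge> 0\<close> in \<open>auto intro: lipschitz_on_subset[OF L]\<close>)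
qed

text \<open>A critical point of the energy in that region is a rest point of the motion: by coercivity both
  \<open>u\<close> and \<open>\<nabla>f(x)\<close> vanish there.\<close>

lemma phase_angle_trajectory:
  assumes "T \<ge> 0" and small: "\<And>t. t \<ge> T \<Longrightarrow> norm (x' t) \<le> \<epsilon>"
  shows "angle_trajectory (energy f lam) (\<lambda>t. (x t, x' t)) (\<lambda>t. (x' t, x'' t)) T \<alpha>"
proof
  show "energy f lam differentiable (at w)" for w by (rule energy_diff)
  show "continuous_on {T..} (\<lambda>t. (x' t, x'' t))"
    using \<open>T \<ge> 0\<close> by (intro continuous_on_Pair continuous_on_subset[OF x'_cont]
        continuous_on_subset[OF x''_cont]) auto
  show "\<alpha> > 0" by (rule \<alpha>_pos)
  fix t assume "t \<ge> T"
  with \<open>T \<ge> 0\<close> have "t \<ge> 0" by simp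
  show "((\<lambda>t. (x t, x' t)) has_vector_derivative (x' t, x'' t)) (at t within {T..})"
    using \<open>T \<ge> 0\<close> by (intro has_vector_derivative_within_subset[OF phase_deriv[OF \<open>t \<ge> 0\<close>]]) auto
  have in\<Gamma>: "(x t, x' t) \<in> cball 0 R \<times> cball 0 \<epsilon>"
    using small[OF \<open>t \<ge> T\<close>] x_in_ball[OF \<open>t \<ge> 0\<close>] by simp
  show "\<alpha> * norm (grad (energy f lam) (x t, x' t)) * norm (x' t, x'' t)
      \<le> - inner (grad (energy f lam) (x t, x' t)) (x' t, x'' t)"
    using angle[OF in\<Gamma>] unfolding phase_velocity[OF \<open>t \<ge> 0\<close>] by simp
  assume "grad (energy f lam) (x t, x' t) = 0"
  with coercive[OF in\<Gamma>] have "lam / 2 * ((norm (x' t))\<^sup>2 + (norm (grad f (x t)))\<^sup>2) \<le> 0" by simp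
  then have "(norm (x' t))\<^sup>2 + (norm (grad f (x t)))\<^sup>2 \<le> 0"
    using lam_pos by (simp add: mult_le_0_iff)
  then have "x' t = 0" "grad f (x t) = 0"
    by (simp_all add: sum_power2_le_zero_iff)
  moreover have "grad \<phi> 0 = 0" using grad_\<phi>_le[of 0] \<epsilon>_pos by simp
  ultimately show "(x' t, x'' t) = 0"
    unfolding phase_velocity[OF \<open>t \<ge> 0\<close>] by (simp add: vfield_def zero_prod_def)
qed

text \<open>The bounded trajectory clusters at some \<open>(x_inf, 0)\<close>, which is critical for the energy because
  \<open>x'\<close> and \<open>\<nabla>f(x)\<close> tend to zero; the KL property at this point gives the convergence and the
  finite length.\<close>

lemma convergence:
  assumes KL: "KL_property (energy f lam)"
  obtains x_inf where "(x \<longlongrightarrow> x_inf) at_top" and "grad f x_inf = 0" and "x' absolutely_integrable_on {0..}"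
proof -
  obtain T where "T \<ge> 0" and T: "\<And>t. t \<ge> T \<Longrightarrow> norm (x' t) \<le> \<epsilon>"
    by (rule velocity_eventually_small) blast
  interpret angle_trajectory "energy f lam" "\<lambda>t. (x t, x' t)" "\<lambda>t. (x' t, x'' t)" T \<alpha>
    by (rule phase_angle_trajectory[OF \<open>T \<ge> 0\<close> T])
  have "\<exists>x_inf\<in>cball 0 R. \<exists>r. strict_mono r \<and> ((\<lambda>n. x (real n)) \<circ> r) \<longlonglongrightarrow> x_inf"
    using compact_cball[of 0 R] x_in_ball 
    by (intro compact_def[THEN iffD1, rule_format]) auto
  then obtain x_inf r where "strict_mono r" and r: "(\<lambda>n. x (real (r n))) \<longlonglongrightarrow> x_inf"
    by (auto simp: comp_def)
  have real_r: "filterlim (\<lambda>n. real (r n)) at_top sequentially"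
    by (intro filterlim_compose[OF filterlim_real_sequentially] filterlim_subseq \<open>strict_mono r\<close>)
  have crit: "grad f x_inf = 0"
  proof (rule LIMSEQ_unique)
    show "(\<lambda>n. grad f (x (real (r n)))) \<longlonglongrightarrow> grad f x_inf"
      using continuous_on_tendsto_compose[OF grad_f_cont r] by simp
    show "(\<lambda>n. grad f (x (real (r n)))) \<longlonglongrightarrow> 0"
      by (rule filterlim_compose[OF gradient_tendsto_zero real_r])
  qed
  have "inner (grad (energy f lam) (x_inf, 0)) v = 0" for v
    by (cases v) (simp add: inner_grad_energy[OF f_diff grad_f_diff] crit)
  then have "grad (energy f lam) (x_inf, 0) = 0"
    using inner_eq_zero_iff by blast
  moreover have "\<forall>z0. grad (energy f lam) z0 = 0 \<longrightarrow> (\<exists>\<theta>. desingularizing (energy f lam) z0 \<theta>)"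
    using KL unfolding KL_property_def ..
  ultimately obtain \<theta> where \<theta>: "desingularizing (energy f lam) (x_inf, 0) \<theta>"
    by metis
  have subseq: "(\<lambda>n. (x (real (r n)), x' (real (r n)))) \<longlonglongrightarrow> (x_inf, 0)"
    by (intro tendsto_Pair r filterlim_compose[OF velocity_tendsto_zero real_r])
  have "\<exists>t\<ge>S. dist (x t, x' t) (x_inf, 0) < e" if "e > 0" for e S
  proof -
    have "\<forall>\<^sub>F n in sequentially. S \<le> real (r n)"
      using real_r by (simp add: filterlim_at_top)
    from eventually_happens'[OF sequentially_bot eventually_conj[OF this tendstoD[OF subseq that]]]
    show ?thesis by blast
  qed
  then have lim: "((\<lambda>t. (x t, x' t)) \<longlongrightarrow> (x_inf, 0)) at_top"
    by (rule tendsto_cluster_point[OF \<theta>])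
  have "(fst \<circ> (\<lambda>t. (x' t, x'' t))) absolutely_integrable_on {T..}"
    by (rule absolutely_integrable_linear[OF convergence_rate(2)[OF \<theta> lim] bounded_linear_fst])
  then have "x' absolutely_integrable_on {T..}" by (simp add: comp_def)
  moreover have "x' absolutely_integrable_on {0..T}"
    by (intro absolutely_integrable_continuous_real continuous_on_subset[OF x'_cont]) auto
  ultimately have "x' absolutely_integrable_on ({0..T} \<union> {T..})"
    by (intro set_integrable_Un) auto
  moreover have "{0..T} \<union> {T..} = {0..}" using \<open>T \<ge> 0\<close> by auto
  ultimately show ?thesis
    using that[of x_inf] tendsto_fst[OF lim] crit by simp
qed

lemma position_rate:
  assumes lim: "(x \<longlongrightarrow> x_inf) at_top" and \<theta>: "desingularizing (energy f lam) (x_inf, 0) \<theta>"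
  shows "\<forall>\<^sub>F t in at_top. norm (x t - x_inf)
           \<le> 1 / \<alpha> * \<theta> (energy f lam (x t, x' t) - energy f lam (x_inf, 0))"
proof -
  obtain T where "T \<ge> 0" and T: "\<And>t. t \<ge> T \<Longrightarrow> norm (x' t) \<le> \<epsilon>"
    by (rule velocity_eventually_small) blast
  interpret angle_trajectory "energy f lam" "\<lambda>t. (x t, x' t)" "\<lambda>t. (x' t, x'' t)" T \<alpha>
    by (rule phase_angle_trajectory[OF \<open>T \<ge> 0\<close> T])
  show ?thesis
    using convergence_rate(1)[OF \<theta> tendsto_Pair[OF lim velocity_tendsto_zero]]
  proof eventually_elim
    case (elim t)
    then show ?case
      using norm_fst_le[of "x t - x_inf" "x' t"] by simp
  qed
qed

end

end

section \<open>Convergence with rate\<close>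

theorem theorem9p2:
  fixes f \<phi> :: "real ^ 'n \<Rightarrow> real"
    and x x' x'' :: "real \<Rightarrow> real ^ 'n"
    and \<beta> \<gamma> \<delta> \<epsilon> p c R :: real
  assumes "\<beta> \<ge> 0"
    and "convex_on UNIV f"
    and "twice_cont_differentiable f"
    and "bdd_below (range f)"
    and "lipschitz_on_bounded_sets (grad f)"
    and "lipschitz_on_bounded_sets (hess f)"
    and "\<forall>\<^sub>F lam in at_right 0. KL_property (energy f lam)"
    and "damping_potential \<phi>"
    and "\<forall>u. \<phi> differentiable (at u)"
    and "locally_lipschitz (grad \<phi>)"
    and "\<gamma> > 0" and "\<delta> > 0" and "\<epsilon> > 0"
    and "\<forall>u. norm u \<le> \<epsilon> \<longrightarrow> \<phi> u \<ge> \<gamma> * (norm u)\<^sup>2 \<and> norm (grad \<phi> u) \<le> \<delta> * norm u"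
    and "p \<ge> 1" and "c > 0"
    and "\<forall>u. \<phi> u \<ge> c * norm u powr p"
    and "\<forall>t\<ge>0. (x has_vector_derivative x' t) (at t within {0..})"
    and "\<forall>t\<ge>0. (x' has_vector_derivative x'' t) (at t within {0..})"
    and "\<forall>t\<ge>0. x'' t + grad \<phi> (x' t) + \<beta> *\<^sub>R blinfun_apply (hess f (x t)) (x' t)
                  + grad f (x t) = 0"
    and "bounded (x ` {0..})"
    and "R \<ge> (SUP t\<in>{0..}. norm (x t))"
  shows "\<exists>x_inf.
      ((x \<longlongrightarrow> x_inf) at_top \<and> grad f x_inf = 0) \<and>
      (x' absolutely_integrable_on {0..} \<and> (x' \<longlongrightarrow> 0) at_top) \<and>
      (\<forall>\<^sub>F lam in at_right 0. \<exists>\<alpha>>0.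
         (\<forall>z \<in> cball 0 R \<times> cball 0 \<epsilon>.
            inner (grad (energy f lam) z) (vfield \<beta> f \<phi> z)
              \<ge> \<alpha> * norm (grad (energy f lam) z) * norm (vfield \<beta> f \<phi> z)) \<and>
         (\<forall>\<theta>. desingularizing (energy f lam) (x_inf, 0) \<theta> \<longrightarrow>
            (\<forall>\<^sub>F t in at_top.
               norm (x t - x_inf)
                 \<le> 1 / \<alpha> * \<theta> (energy f lam (x t, x' t) - energy f lam (x_inf, 0)))))"
proof -
  have "norm (x t) \<le> R" if "t \<ge> 0" for t
  proof -
    have "bdd_above ((\<lambda>t. norm (x t)) ` {0..})"
      using \<open>bounded (x ` {0..})\<close> by (auto simp: bounded_iff bdd_above_def)
    then have "norm (x t) \<le> (SUP t\<in>{0..}. norm (x t))"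
      using that by (intro cSUP_upper) auto
    then show ?thesis using assms by linarith
  qed
  then interpret inertial_trajectory f \<phi> \<beta> \<gamma> \<delta> \<epsilon> x x' x'' p c R
    using assms by unfold_locales
      (auto simp: damping_potential_def intro: locally_lipschitz_imp_continuous_on)
  \<comment> \<open>Convergence needs a single admissible parameter; the rate is then derived for each of them
    with its own \<open>\<alpha>\<close>, since the limit does not depend on the parameter.\<close>
  define good where "good lam \<alpha> \<longleftrightarrow> \<alpha> > 0 \<and> (\<forall>z \<in> cball 0 R \<times> cball 0 \<epsilon>.
      inner (grad (energy f lam) z) (vfield \<beta> f \<phi> z)
        \<ge> \<alpha> * norm (grad (energy f lam) z) * norm (vfield \<beta> f \<phi> z) \<and>
      inner (grad (energy f lam) z) (vfield \<beta> f \<phi> z)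
        \<ge> lam / 2 * ((norm (snd z))\<^sup>2 + (norm (grad f (fst z)))\<^sup>2))" for lam \<alpha>
  have good: "\<forall>\<^sub>F lam in at_right 0. lam > 0 \<and> (\<exists>\<alpha>. good lam \<alpha>)"
    unfolding good_def by (intro eventually_conj eventually_at_right_less angle_condition)
  from eventually_happens[OF eventually_conj[OF this assms(7)]]
  obtain lam \<alpha> where "lam > 0" "good lam \<alpha>" "KL_property (energy f lam)" by auto
  then obtain x_inf where lim: "(x \<longlongrightarrow> x_inf) at_top" and "grad f x_inf = 0"
    and "x' absolutely_integrable_on {0..}"
    using convergence[of lam \<alpha>] unfolding good_def by blast
  moreover have "\<forall>\<^sub>F lam in at_right 0. \<exists>\<alpha>>0.
         (\<forall>z \<in> cball 0 R \<times> cball 0 \<epsilon>.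
            inner (grad (energy f lam) z) (vfield \<beta> f \<phi> z)
              \<ge> \<alpha> * norm (grad (energy f lam) z) * norm (vfield \<beta> f \<phi> z)) \<and>
         (\<forall>\<theta>. desingularizing (energy f lam) (x_inf, 0) \<theta> \<longrightarrow>
            (\<forall>\<^sub>F t in at_top.
               norm (x t - x_inf)
                 \<le> 1 / \<alpha> * \<theta> (energy f lam (x t, x' t) - energy f lam (x_inf, 0))))"
    using good
  proof eventually_elim
    case (elim lam)
    then obtain \<alpha> where "lam > 0" "good lam \<alpha>" by blast
    then show ?case
      using position_rate[of lam \<alpha> x_inf] lim unfolding good_def by (intro exI[of _ \<alpha>]) blast
  qed
  ultimately show ?thesis using velocity_tendsto_zero by blast
qed

end
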